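(* For every $K\ge1$ and all natural numbers $k,m\ge1$ there is $\eta=\eta(K,k,m)>0$ with the following property. Let $G$ be an arbitrary group and $A\subseteq G$ a finite subset with $|A\cdot A\cdot A|\le K|A|$, and let $f_1,f_2,f_3:A\to A^{\odot m}$ be functions each of whose fibers has size at most $k$, such that $f_1(a)\cdot f_2(a)=f_3(a)$ for all $a\in A$. Then \[|\{(a_1,a_2,a_3)\in A\times A\times A : f_1(a_1)\cdot f_2(a_2)=f_3(a_3)\}|\ge\eta|A|^2.\]
   Context: For a subset $A$ of a group $G$, $A^{\odot m}$ denotes the $m$-fold product set $A_1\cdot A_1\cdots A_1$ where $A_1=A\cup A^{-1}\cup\{\mathrm{id}_G\}$. *)

theory Defs
  imports Complex_Main "HOL-Algebra.Coset"
begin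

definition sym_closure :: "('a, 'b) monoid_scheme \<Rightarrow> 'a set \<Rightarrow> 'a set" where
  "sym_closure G A = A \<union> (set_inv\<^bsub>G\<^esub> A) \<union> {\<one>\<^bsub>G\<^esub>}"

primrec sym_prod :: "('a, 'b) monoid_scheme \<Rightarrow> 'a set \<Rightarrow> nat \<Rightarrow> 'a set" where
  "sym_prod G A 0 = {\<one>\<^bsub>G\<^esub>}"
| "sym_prod G A (Suc m) = sym_prod G A m <#>\<^bsub>G\<^esub> sym_closure G A"

definition fibers_bounded :: "'a set \<Rightarrow> ('a \<Rightarrow> 'c) \<Rightarrow> nat \<Rightarrow> bool" where
  "fibers_bounded A f k \<longleftrightarrow> (\<forall>y. card {a \<in> A. f a = y} \<le> k)"

definition many_solutions ::
    "('a, 'b) monoid_scheme \<Rightarrow> real \<Rightarrow> nat \<Rightarrow> nat \<Rightarrow> real \<Rightarrow> bool" where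
  "many_solutions G K k m \<eta> \<longleftrightarrow>
    (\<forall>A f1 f2 f3.
      A \<subseteq> carrier G \<longrightarrow> finite A \<longrightarrow>
      real (card (A <#>\<^bsub>G\<^esub> A <#>\<^bsub>G\<^esub> A)) \<le> K * real (card A) \<longrightarrow>
      f1 \<in> A \<rightarrow> sym_prod G A m \<longrightarrow>
      f2 \<in> A \<rightarrow> sym_prod G A m \<longrightarrow>
      f3 \<in> A \<rightarrow> sym_prod G A m \<longrightarrow>
      fibers_bounded A f1 k \<longrightarrow> fibers_bounded A f2 k \<longrightarrow> fibers_bounded A f3 k \<longrightarrow>
      (\<forall>a\<in>A. f1 a \<otimes>\<^bsub>G\<^esub> f2 a = f3 a) \<longrightarrow>
      real (card {(a1, a2, a3). a1 \<in> A \<and> a2 \<in> A \<and> a3 \<in> A \<and> f1 a1 \<otimes>\<^bsub>G\<^esub> f2 a2 = f3 a3})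
        \<ge> \<eta> * (real (card A))\<^sup>2)"

(* HOL cannot quantify over types inside a formula, so "there is eta such that for every
   group G" cannot be written with G ranging over groups of all types: the polymorphic
   statement "EX eta. ALL G :: ('a, 'b) monoid_scheme" would let eta depend on 'a and 'b.
   The intended uniformity is therefore expressed in two steps, both to be asserted together:
   some eta > 0 works for all groups with carrier in nat, and every eta > 0 that does so
   works for all groups over the arbitrary types 'a and 'b. As the first step mentions no
   type variable, eta depends on K, k and m only. *)

end

theory Submission
  imports Defs "HOL-Algebra.Generated_Groups" "HOL-Library.Countable_Set"
begin

text \<open>
  Let \<open>P = sym_prod G A (Suc m)\<close>; by Ruzsa's triangle inequality, small tripling bounds \<open>|P|\<close> by a constant times
  \<open>|A|\<close>. On three copies of \<open>P\<close> join \<open>x\<close> to \<open>x s\<close>, with \<open>s\<close> in \<open>f\<^sub>1(A)\<close> between the first and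
  the second copy, in \<open>f\<^sub>2(A)\<close> between the second and the third, and in \<open>f\<^sub>3(A)\<close> between the first
  and the third. Each pair \<open>(x, a) \<in> A \<times> A\<close> gives the triangle \<open>x, x f\<^sub>1(a), x f\<^sub>3(a)\<close>, and an edge lies
  in at most \<open>k\<close> of these, so at least \<open>|A|\<^sup>2/k\<close> edges are needed to destroy all triangles. The
  triangle removal lemma then yields \<open>\<delta> |P|\<^sup>3\<close> triangles, and each solution of \<open>s\<^sub>1 s\<^sub>2 = s\<^sub>3\<close> comes from
  at most \<open>|P|\<close> of them. For the uniformity in the carrier type, the subgroup generated by \<open>A\<close> is
  countable and hence isomorphic to a group on a set of naturals.
\<close>

section \<open>Conditional averages and energy\<close>

text \<open>The conditional expectation of \<open>f\<close> given the colouring \<open>c\<close>,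
  for the uniform measure on \<open>\<Omega>\<close>. A colouring stands in for a partition;
  \<open>c'\<close> refines \<open>c\<close> when equal \<open>c'\<close>-colours force equal
  \<open>c\<close>-colours.\<close>

definition cond_avg :: "'a set \<Rightarrow> ('a \<Rightarrow> 'c) \<Rightarrow> ('a \<Rightarrow> real) \<Rightarrow> 'a \<Rightarrow> real" where
  "cond_avg \<Omega> c f x = (\<Sum>y | y \<in> \<Omega> \<and> c y = c x. f y) / real (card {y \<in> \<Omega>. c y = c x})"

lemma cond_avg_cong: "c x = c y \<Longrightarrow> cond_avg \<Omega> c f x = cond_avg \<Omega> c f y"
  by (simp add: cond_avg_def)

text \<open>On each colour class \<open>g\<close> is constant and the average has the same sum as
  \<open>f\<close>: conditional expectation is the orthogonal projection onto functions of the
  colour.\<close>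

lemma sum_cond_avg_mult:
  fixes f :: "'a \<Rightarrow> real"
  assumes "finite \<Omega>" and g: "\<And>x y. \<lbrakk>x \<in> \<Omega>; y \<in> \<Omega>; c x = c y\<rbrakk> \<Longrightarrow> g x = g y"
  shows "(\<Sum>x\<in>\<Omega>. cond_avg \<Omega> c f x * g x) = (\<Sum>x\<in>\<Omega>. f x * g x)"
proof -
  have fibre: "(\<Sum>x | x \<in> \<Omega> \<and> c x = l. cond_avg \<Omega> c f x * g x) = (\<Sum>x | x \<in> \<Omega> \<and> c x = l. f x * g x)"
    if l: "l \<in> c ` \<Omega>" for l
  proof -
    obtain z where z: "z \<in> \<Omega>" "l = c z" using l by auto
    let ?F = "{x \<in> \<Omega>. c x = l}"
    have gz: "g x = g z" if "x \<in> ?F" for x using that z g[of x z] by auto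
    have card0: "card ?F \<noteq> 0" using z assms(1) by auto
    have "(\<Sum>x\<in>?F. cond_avg \<Omega> c f x * g x) = (\<Sum>x\<in>?F. (\<Sum>y\<in>?F. f y) / real (card ?F) * g z)"
      by (rule sum.cong[OF refl]) (subst gz, auto simp: cond_avg_def)
    also have "\<dots> = (\<Sum>y\<in>?F. f y) * g z" using card0 by simp
    also have "\<dots> = (\<Sum>x\<in>?F. f x * g z)" by (simp add: sum_distrib_right)
    also have "\<dots> = (\<Sum>x\<in>?F. f x * g x)"
      by (rule sum.cong[OF refl]) (simp only: gz)
    finally show ?thesis .
  qed
  show ?thesis
    unfolding sum.image_gen[OF assms(1), where g = c and h = "\<lambda>x. cond_avg \<Omega> c f x * g x"]
      sum.image_gen[OF assms(1), where g = c and h = "\<lambda>x. f x * g x"]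
    by (rule sum.cong[OF refl fibre])
qed

text \<open>By the projection property, \<open>f\<close> and both of its averages have the same
  inner product with the coarse average, so the difference of the averages is orthogonal to the
  coarse one.\<close>

lemma cond_avg_pythagoras:
  fixes f :: "'a \<Rightarrow> real"
  assumes "finite \<Omega>" and fine: "\<And>x y. \<lbrakk>x \<in> \<Omega>; y \<in> \<Omega>; c' x = c' y\<rbrakk> \<Longrightarrow> c x = c y"
  shows "(\<Sum>x\<in>\<Omega>. (cond_avg \<Omega> c' f x - cond_avg \<Omega> c f x)\<^sup>2) =
    (\<Sum>x\<in>\<Omega>. (cond_avg \<Omega> c' f x)\<^sup>2) - (\<Sum>x\<in>\<Omega>. (cond_avg \<Omega> c f x)\<^sup>2)"
proof -
  have "(\<Sum>x\<in>\<Omega>. cond_avg \<Omega> c' f x * cond_avg \<Omega> c f x) = (\<Sum>x\<in>\<Omega>. f x * cond_avg \<Omega> c f x)"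
    by (rule sum_cond_avg_mult[OF assms(1)]) (blast intro: cond_avg_cong fine)
  also have "\<dots> = (\<Sum>x\<in>\<Omega>. cond_avg \<Omega> c f x * cond_avg \<Omega> c f x)"
    by (rule sum_cond_avg_mult[OF assms(1), symmetric]) (rule cond_avg_cong)
  finally have *: "(\<Sum>x\<in>\<Omega>. cond_avg \<Omega> c' f x * cond_avg \<Omega> c f x) = (\<Sum>x\<in>\<Omega>. (cond_avg \<Omega> c f x)\<^sup>2)"
    by (simp add: power2_eq_square)
  have "(\<Sum>x\<in>\<Omega>. (cond_avg \<Omega> c' f x - cond_avg \<Omega> c f x)\<^sup>2) =
     (\<Sum>x\<in>\<Omega>. (cond_avg \<Omega> c' f x)\<^sup>2) + (\<Sum>x\<in>\<Omega>. (cond_avg \<Omega> c f x)\<^sup>2)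
     - 2 * (\<Sum>x\<in>\<Omega>. cond_avg \<Omega> c' f x * cond_avg \<Omega> c f x)"
    by (simp add: power2_diff sum.distrib sum_subtractf sum_distrib_left mult.assoc)
  then show ?thesis using * by simp
qed

text \<open>A form of Cauchy-Schwarz, read off from expanding
  \<open>(D x - s * \<epsilon>)\<^sup>2 \<ge> 0\<close> with \<open>s\<close> the sign of the
  sum.\<close>

lemma sum_square_ge:
  fixes D :: "'a \<Rightarrow> real"
  assumes "finite T" "\<epsilon> \<ge> 0" "\<bar>\<Sum>x\<in>T. D x\<bar> \<ge> \<epsilon> * real (card T)"
  shows "(\<Sum>x\<in>T. (D x)\<^sup>2) \<ge> \<epsilon>\<^sup>2 * real (card T)"
proof -
  define s where "s = (if (\<Sum>x\<in>T. D x) \<ge> 0 then 1 else -1 :: real)"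
  have s: "s * (\<Sum>x\<in>T. D x) \<ge> \<epsilon> * real (card T)" "s * s = 1" using assms by (auto simp: s_def)
  have "0 \<le> (\<Sum>x\<in>T. (D x - s * \<epsilon>)\<^sup>2)" by (simp add: sum_nonneg)
  also have "\<dots> = (\<Sum>x\<in>T. (D x)\<^sup>2 + \<epsilon>\<^sup>2 - 2 * \<epsilon> * (s * D x))"
  proof (rule sum.cong[OF refl])
    fix x
    have "(D x - s * \<epsilon>)\<^sup>2 = (D x)\<^sup>2 + (s * s) * \<epsilon>\<^sup>2 - 2 * \<epsilon> * (s * D x)"
      by (simp add: power2_eq_square algebra_simps)
    then show "(D x - s * \<epsilon>)\<^sup>2 = (D x)\<^sup>2 + \<epsilon>\<^sup>2 - 2 * \<epsilon> * (s * D x)" using s(2) by simp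
  qed
  also have "\<dots> = (\<Sum>x\<in>T. (D x)\<^sup>2) + \<epsilon>\<^sup>2 * card T - 2 * \<epsilon> * (s * (\<Sum>x\<in>T. D x))"
    by (simp add: sum.distrib sum_subtractf sum_distrib_left)
  finally have "(\<Sum>x\<in>T. (D x)\<^sup>2) \<ge> 2 * \<epsilon> * (s * (\<Sum>x\<in>T. D x)) - \<epsilon>\<^sup>2 * card T" by simp
  moreover have "2 * \<epsilon> * (s * (\<Sum>x\<in>T. D x)) \<ge> 2 * \<epsilon> * (\<epsilon> * real (card T))"
    by (rule mult_left_mono) (use s assms in auto)
  ultimately show ?thesis by (simp add: power2_eq_square algebra_simps)
qed

text \<open>Each \<open>T l\<close> witnesses that \<open>f\<close> is unevenly distributed on the
  class of colour \<open>l\<close>. The finer colouring resolves \<open>T l\<close>, so on this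
  class the two averages differ by at least \<open>\<epsilon>\<^sup>2 * card (T l)\<close> in square
  sum; Pythagoras turns this into a gain of energy.\<close>

lemma energy_increment:
  fixes f :: "'a \<Rightarrow> real"
  assumes fin: "finite \<Omega>" and "\<epsilon> \<ge> 0" "\<beta> \<ge> 0"
    and fine: "\<And>x y. \<lbrakk>x \<in> \<Omega>; y \<in> \<Omega>; c' x = c' y\<rbrakk> \<Longrightarrow> c x = c y"
    and T: "\<And>l. l \<in> L \<Longrightarrow> T l \<subseteq> {x \<in> \<Omega>. c x = l}"
    and T_fine: "\<And>l x y. \<lbrakk>l \<in> L; x \<in> T l; y \<in> \<Omega>; c' x = c' y\<rbrakk> \<Longrightarrow> y \<in> T l"
    and T_large: "\<And>l. l \<in> L \<Longrightarrow> real (card (T l)) \<ge> \<beta> * real (card {x \<in> \<Omega>. c x = l})"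
    and T_dev: "\<And>l. l \<in> L \<Longrightarrow> \<bar>\<Sum>x\<in>T l. f x - cond_avg \<Omega> c f x\<bar> \<ge> \<epsilon> * real (card (T l))"
  shows "(\<Sum>x\<in>\<Omega>. (cond_avg \<Omega> c' f x)\<^sup>2) \<ge> (\<Sum>x\<in>\<Omega>. (cond_avg \<Omega> c f x)\<^sup>2)
    + \<epsilon>\<^sup>2 * \<beta> * real (card {x \<in> \<Omega>. c x \<in> L})"
proof -
  let ?D = "\<lambda>x. cond_avg \<Omega> c' f x - cond_avg \<Omega> c f x"
  let ?I = "{x \<in> \<Omega>. c x \<in> L}"
  have fibre: "\<epsilon>\<^sup>2 * \<beta> * real (card {x \<in> \<Omega>. c x = l}) \<le> (\<Sum>x | x \<in> \<Omega> \<and> c x = l. (?D x)\<^sup>2)"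
    if l: "l \<in> L" for l
  proof -
    have finT: "finite (T l)" using T[OF l] fin by (auto intro: finite_subset)
    have sub: "T l \<subseteq> \<Omega>" using T[OF l] by auto
    have sum_ind: "(\<Sum>x\<in>\<Omega>. h x * (if x \<in> T l then 1 else 0)) = (\<Sum>x\<in>T l. h x)" for h :: "'a \<Rightarrow> real"
    proof -
      have "(\<Sum>x\<in>T l. h x) = (\<Sum>x\<in>T l. h x * (if x \<in> T l then 1 else 0))" by simp
      also have "\<dots> = (\<Sum>x\<in>\<Omega>. h x * (if x \<in> T l then 1 else 0))"
        by (rule sum.mono_neutral_left) (use fin sub in auto)
      finally show ?thesis ..
    qed
    \<comment> \<open>\<open>T l\<close> is a union of \<open>c'\<close>-classes, so its indicator
      is a function of the \<open>c'\<close>-colour and the projection property applies to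
      it.\<close>
    have "(\<Sum>x\<in>\<Omega>. cond_avg \<Omega> c' f x * (if x \<in> T l then 1 else 0))
        = (\<Sum>x\<in>\<Omega>. f x * (if x \<in> T l then 1 else 0))"
      by (rule sum_cond_avg_mult[OF fin]) (use T_fine[OF l] in force)
    then have "(\<Sum>x\<in>T l. ?D x) = (\<Sum>x\<in>T l. f x - cond_avg \<Omega> c f x)"
      by (simp only: sum_ind sum_subtractf)
    then have "(\<Sum>x\<in>T l. (?D x)\<^sup>2) \<ge> \<epsilon>\<^sup>2 * real (card (T l))"
      using sum_square_ge[OF finT, of \<epsilon> ?D] assms(2) T_dev[OF l] by simp
    moreover have "\<epsilon>\<^sup>2 * real (card (T l)) \<ge> \<epsilon>\<^sup>2 * (\<beta> * real (card {x \<in> \<Omega>. c x = l}))"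
      by (rule mult_left_mono[OF T_large[OF l]]) simp
    moreover have "(\<Sum>x\<in>T l. (?D x)\<^sup>2) \<le> (\<Sum>x | x \<in> \<Omega> \<and> c x = l. (?D x)\<^sup>2)"
      by (rule sum_mono2) (use fin T[OF l] in auto)
    ultimately show ?thesis by (simp add: mult.assoc)
  qed
  have finI: "finite ?I" using fin by simp
  have fibI: "{x \<in> ?I. c x = l} = {x \<in> \<Omega>. c x = l}" if "l \<in> c ` ?I" for l using that by auto
  have "real (card ?I) = (\<Sum>l\<in>c ` ?I. real (card {x \<in> \<Omega>. c x = l}))"
    using sum.image_gen[OF finI, of "\<lambda>_. 1::real" c] fibI by simp
  then have "\<epsilon>\<^sup>2 * \<beta> * real (card ?I) = (\<Sum>l\<in>c ` ?I. \<epsilon>\<^sup>2 * \<beta> * real (card {x \<in> \<Omega>. c x = l}))"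
    by (simp add: sum_distrib_left)
  also have "\<dots> \<le> (\<Sum>l\<in>c ` ?I. \<Sum>x | x \<in> \<Omega> \<and> c x = l. (?D x)\<^sup>2)"
    by (rule sum_mono) (use fibre in auto)
  also have "\<dots> = (\<Sum>x\<in>?I. (?D x)\<^sup>2)"
    using sum.image_gen[OF finI, of "\<lambda>x. (?D x)\<^sup>2" c] fibI by simp
  also have "\<dots> \<le> (\<Sum>x\<in>\<Omega>. (?D x)\<^sup>2)"
    by (rule sum_mono2) (use fin in auto)
  also have "\<dots> = (\<Sum>x\<in>\<Omega>. (cond_avg \<Omega> c' f x)\<^sup>2) - (\<Sum>x\<in>\<Omega>. (cond_avg \<Omega> c f x)\<^sup>2)"
    by (rule cond_avg_pythagoras[OF fin fine])
  finally show ?thesis by simp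
qed

section \<open>Szemeredi's regularity lemma\<close>

text \<open>
  A finite family \<open>\<S>\<close> of sets encodes the partition of \<open>V\<close> into its atoms, so that refining a
  partition means enlarging the family.
\<close>

definition signature :: "'v set set \<Rightarrow> 'v \<Rightarrow> 'v set set" where
  "signature \<S> x = {S \<in> \<S>. x \<in> S}"

definition atom :: "'v set \<Rightarrow> 'v set set \<Rightarrow> 'v \<Rightarrow> 'v set" where
  "atom V \<S> x = {y \<in> V. signature \<S> y = signature \<S> x}"

definition edge_density :: "('v \<times> 'v) set \<Rightarrow> 'v set \<Rightarrow> 'v set \<Rightarrow> real" where
  "edge_density E U W = real (card (E \<inter> U \<times> W)) / (real (card U) * real (card W))"

text \<open>The deviation is multiplied out instead of comparing densities, so that empty
  \<open>U'\<close> or \<open>W'\<close> involve no division by zero.\<close>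

definition regular_pair :: "('v \<times> 'v) set \<Rightarrow> real \<Rightarrow> 'v set \<Rightarrow> 'v set \<Rightarrow> bool" where
  "regular_pair E \<epsilon> U W \<longleftrightarrow>
    (\<forall>U'\<subseteq>U. \<forall>W'\<subseteq>W. \<epsilon> * card U \<le> card U' \<longrightarrow> \<epsilon> * card W \<le> card W' \<longrightarrow>
      \<bar>real (card (E \<inter> U' \<times> W')) - edge_density E U W * (real (card U') * real (card W'))\<bar>
        \<le> \<epsilon> * (real (card U') * real (card W')))"

text \<open>Irregularity is measured in pairs of vertices, which weights each pair of atoms by its
  size and allows atoms of very different sizes.\<close>

definition irregular :: "'v set \<Rightarrow> ('v \<times> 'v) set \<Rightarrow> real \<Rightarrow> 'v set set \<Rightarrow> ('v \<times> 'v) set" where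
  "irregular V E \<epsilon> \<S> = {(x, y) \<in> V \<times> V. \<not> regular_pair E \<epsilon> (atom V \<S> x) (atom V \<S> y)}"

text \<open>The mean-square density of the partition, without the usual normalising factor
  \<open>1 / (card V)\<^sup>2\<close>: each pair of vertices contributes the squared edge density
  between its two atoms.\<close>

definition energy :: "'v set \<Rightarrow> ('v \<times> 'v) set \<Rightarrow> 'v set set \<Rightarrow> real" where
  "energy V E \<S> = (\<Sum>\<omega>\<in>V \<times> V.
     (cond_avg (V \<times> V) (map_prod (signature \<S>) (signature \<S>)) (\<lambda>\<omega>. of_bool (\<omega> \<in> E)) \<omega>)\<^sup>2)"

section \<open>Refining a partition at its irregular pairs\<close>

lemma signature_mono: "\<lbrakk>\<S> \<subseteq> \<S>'; signature \<S>' x = signature \<S>' y\<rbrakk> \<Longrightarrow> signature \<S> x = signature \<S> y"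
  unfolding signature_def by blast

lemma signature_mem: "\<lbrakk>signature \<S> x = signature \<S> y; S \<in> \<S>; x \<in> S\<rbrakk> \<Longrightarrow> y \<in> S"
  unfolding signature_def by blast

lemma energy_le:
  assumes "finite V"
  shows "energy V E \<S> \<le> (real (card V))\<^sup>2"
proof -
  have "\<bar>cond_avg (V \<times> V) c (\<lambda>\<omega>. of_bool (\<omega> \<in> E)) \<omega>\<bar> \<le> 1" for c :: "'a \<times> 'a \<Rightarrow> 'c" and \<omega>
  proof -
    have "(\<Sum>y | y \<in> V \<times> V \<and> c y = c \<omega>. of_bool (y \<in> E)) \<le> (\<Sum>y | y \<in> V \<times> V \<and> c y = c \<omega>. 1::real)"
      by (rule sum_mono) simp
    moreover have "0 \<le> (\<Sum>y | y \<in> V \<times> V \<and> c y = c \<omega>. of_bool (y \<in> E) :: real)"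
      by (rule sum_nonneg) simp
    ultimately show ?thesis
      by (auto simp: cond_avg_def divide_le_eq_1)
  qed
  then have "energy V E \<S> \<le> (\<Sum>\<omega>\<in>V \<times> V. 1)"
    unfolding energy_def by (intro sum_mono) (simp add: abs_square_le_1)
  then show ?thesis by (simp add: power2_eq_square card_cartesian_product)
qed

text \<open>Both sides of a witness of irregularity are added to the family for each irregular pair
  of atoms. There are at most \<open>4 ^ card \<S>\<close> such pairs, and the witnesses make the
  energy grow.\<close>

lemma refine_irregular:
  fixes V :: "'v set"
  assumes V: "finite V" and S: "finite \<S>" and \<epsilon>: "\<epsilon> > 0"
    and irr: "real (card (irregular V E \<epsilon> \<S>)) > \<epsilon> * (real (card V))\<^sup>2"
  obtains \<S>' where "finite \<S>'" "card \<S>' \<le> card \<S> + 2 * 4 ^ card \<S>"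
    "energy V E \<S>' \<ge> energy V E \<S> + \<epsilon> ^ 5 * (real (card V))\<^sup>2"
proof -
  define fib where "fib l = {x \<in> V. signature \<S> x = l}" for l
  have atom_fib: "atom V \<S> x = fib (signature \<S> x)" for x by (simp add: atom_def fib_def)
  \<comment> \<open>Atoms are addressed by subsets of \<open>\<S>\<close>. A subset that is not a
    signature has an empty fibre, and a pair with an empty side is regular, so \<open>L\<close>
    contains only pairs of actual atoms.\<close>
  define L where "L = {p \<in> Pow \<S> \<times> Pow \<S>. \<not> regular_pair E \<epsilon> (fib (fst p)) (fib (snd p))}"
  have "L \<subseteq> Pow \<S> \<times> Pow \<S>" by (auto simp: L_def)
  moreover have fin2: "finite (Pow \<S> \<times> Pow \<S>)" using S by simp
  ultimately have finL: "finite L" and "card L \<le> card (Pow \<S> \<times> Pow \<S>)"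
    by (auto intro: finite_subset card_mono)
  note this(2)
  also have "card (Pow \<S> \<times> Pow \<S>) = 4 ^ card \<S>"
    using S by (simp add: card_Pow card_cartesian_product flip: power_mult_distrib)
  finally have cardL: "card L \<le> 4 ^ card \<S>" .
  define Q where "Q p q \<longleftrightarrow> fst q \<subseteq> fib (fst p) \<and> snd q \<subseteq> fib (snd p) \<and>
      \<epsilon> * card (fib (fst p)) \<le> card (fst q) \<and> \<epsilon> * card (fib (snd p)) \<le> card (snd q) \<and>
      \<bar>real (card (E \<inter> fst q \<times> snd q)) -
          edge_density E (fib (fst p)) (fib (snd p)) * (real (card (fst q)) * real (card (snd q)))\<bar>
        > \<epsilon> * (real (card (fst q)) * real (card (snd q)))" for p and q :: "'v set \<times> 'v set"
  have "\<forall>p\<in>L. \<exists>q. Q p q"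
    by (auto simp: L_def Q_def regular_pair_def not_le)
  then obtain q where "\<forall>p\<in>L. Q p (q p)" using bchoice by meson
  then have q: "\<And>p. p \<in> L \<Longrightarrow> fst (q p) \<subseteq> fib (fst p)" "\<And>p. p \<in> L \<Longrightarrow> snd (q p) \<subseteq> fib (snd p)"
      "\<And>p. p \<in> L \<Longrightarrow> \<epsilon> * card (fib (fst p)) \<le> card (fst (q p))"
      "\<And>p. p \<in> L \<Longrightarrow> \<epsilon> * card (fib (snd p)) \<le> card (snd (q p))"
      "\<And>p. p \<in> L \<Longrightarrow> \<bar>real (card (E \<inter> fst (q p) \<times> snd (q p))) -
          edge_density E (fib (fst p)) (fib (snd p)) * (real (card (fst (q p))) * real (card (snd (q p))))\<bar>
        > \<epsilon> * (real (card (fst (q p))) * real (card (snd (q p))))"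
    unfolding Q_def by blast+
  \<comment> \<open>With the witnesses in the family, each of them becomes a union of atoms of the
    refined partition.\<close>
  define \<S>' where "\<S>' = \<S> \<union> ((fst \<circ> q) ` L \<union> (snd \<circ> q) ` L)"
  have fin': "finite \<S>'" using S finL by (simp add: \<S>'_def)
  have "card \<S>' \<le> card \<S> + (card ((fst \<circ> q) ` L) + card ((snd \<circ> q) ` L))"
    unfolding \<S>'_def by (intro order.trans[OF card_Un_le] add_mono order.refl card_Un_le)
  also have "\<dots> \<le> card \<S> + (card L + card L)"
    by (intro add_mono order.refl card_image_le finL)
  finally have card': "card \<S>' \<le> card \<S> + 2 * 4 ^ card \<S>" using cardL by simp
  let ?c = "map_prod (signature \<S>) (signature \<S>)" and ?c' = "map_prod (signature \<S>') (signature \<S>')"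
  let ?f = "\<lambda>\<omega>. of_bool (\<omega> \<in> E) :: real"
  let ?T = "\<lambda>p. fst (q p) \<times> snd (q p)"
  have fibre: "{\<omega> \<in> V \<times> V. ?c \<omega> = p} = fib (fst p) \<times> fib (snd p)" for p
    by (auto simp: fib_def)
  have avg: "cond_avg (V \<times> V) ?c ?f \<omega> = edge_density E (fib (fst p)) (fib (snd p))" if "?c \<omega> = p" for \<omega> p
  proof -
    have "(\<Sum>y\<in>fib (fst p) \<times> fib (snd p). ?f y) = real (card (E \<inter> fib (fst p) \<times> fib (snd p)))"
      using V by (simp add: fib_def sum_of_bool_eq Int_commute)
    then show ?thesis
      unfolding cond_avg_def that fibre by (simp add: edge_density_def card_cartesian_product)
  qed
  have finq: "finite (fst (q p))" "finite (snd (q p))" if "p \<in> L" for p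
    using q(1,2)[OF that] V by (auto simp: fib_def intro: finite_subset)
  \<comment> \<open>Each side of a witness takes at least the share \<open>\<epsilon>\<close> of its
    atom, hence \<open>\<beta> = \<epsilon> * \<epsilon>\<close>. The fifth factor
    \<open>\<epsilon>\<close> comes from the number of irregular pairs.\<close>
  have "energy V E \<S>' \<ge> energy V E \<S> + \<epsilon>\<^sup>2 * (\<epsilon> * \<epsilon>) * real (card {\<omega> \<in> V \<times> V. ?c \<omega> \<in> L})"
    unfolding energy_def
  proof (rule energy_increment[where T = ?T])
    show "finite (V \<times> V)" "0 \<le> \<epsilon>" "0 \<le> \<epsilon> * \<epsilon>" using V \<epsilon> by auto
    show "?c x = ?c y" if "?c' x = ?c' y" for x y
    proof -
      have "\<S> \<subseteq> \<S>'" by (simp add: \<S>'_def)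
      then show ?thesis
        using that by (cases x; cases y) (simp only: map_prod_simp prod.inject, metis signature_mono)
    qed
    show "?T p \<subseteq> {\<omega> \<in> V \<times> V. ?c \<omega> = p}" if "p \<in> L" for p
      unfolding fibre using q(1,2)[OF that] by blast
    show "y \<in> ?T p" if "p \<in> L" "x \<in> ?T p" "?c' x = ?c' y" for p x y
    proof -
      have "fst (q p) \<in> \<S>'" "snd (q p) \<in> \<S>'" using that(1) by (auto simp: \<S>'_def)
      then show ?thesis using that(2,3) by (cases x; cases y) (auto intro: signature_mem[of \<S>'])
    qed
    show "\<epsilon> * \<epsilon> * real (card {\<omega> \<in> V \<times> V. ?c \<omega> = p}) \<le> real (card (?T p))" if "p \<in> L" for p
    proof -
      have "(\<epsilon> * card (fib (fst p))) * (\<epsilon> * card (fib (snd p))) \<le> real (card (fst (q p))) * real (card (snd (q p)))"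
        by (rule mult_mono) (use q(3,4)[OF that] \<epsilon> in auto)
      then show ?thesis unfolding fibre by (simp add: card_cartesian_product mult_ac)
    qed
    show "\<epsilon> * real (card (?T p)) \<le> \<bar>\<Sum>x\<in>?T p. ?f x - cond_avg (V \<times> V) ?c ?f x\<bar>" if "p \<in> L" for p
    proof -
      have "(\<Sum>x\<in>?T p. ?f x) = real (card (E \<inter> ?T p))"
        using finq[OF that] by (simp add: sum_of_bool_eq Int_commute)
      moreover have "(\<Sum>x\<in>?T p. cond_avg (V \<times> V) ?c ?f x) = (\<Sum>x\<in>?T p. edge_density E (fib (fst p)) (fib (snd p)))"
        by (rule sum.cong[OF refl], rule avg) (use q(1,2)[OF that] in \<open>cases p, auto simp: fib_def\<close>)
      ultimately have "(\<Sum>x\<in>?T p. ?f x - cond_avg (V \<times> V) ?c ?f x) = real (card (E \<inter> ?T p))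
          - edge_density E (fib (fst p)) (fib (snd p)) * (real (card (fst (q p))) * real (card (snd (q p))))"
        by (simp add: sum_subtractf card_cartesian_product)
      then show ?thesis using q(5)[OF that] by (simp add: card_cartesian_product)
    qed
  qed
  moreover have "{\<omega> \<in> V \<times> V. ?c \<omega> \<in> L} = irregular V E \<epsilon> \<S>"
    by (auto simp: irregular_def L_def atom_fib signature_def)
  moreover have "\<epsilon>\<^sup>2 * (\<epsilon> * \<epsilon>) * real (card (irregular V E \<epsilon> \<S>)) \<ge> \<epsilon>\<^sup>2 * (\<epsilon> * \<epsilon>) * (\<epsilon> * (real (card V))\<^sup>2)"
    by (rule mult_left_mono) (use irr \<epsilon> in auto)
  ultimately have "energy V E \<S>' \<ge> energy V E \<S> + \<epsilon> ^ 5 * (real (card V))\<^sup>2"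
    by (simp add: eval_nat_numeral mult_ac)
  then show ?thesis using that fin' card' by blast
qed

text \<open>Every refinement of an irregular partition raises the energy by a fixed share of
  \<open>(card V)\<^sup>2\<close>, which is also its upper bound, so the process stops.
  \<open>M\<close> bounds the number of generating sets, hence the number of atoms by
  \<open>2 ^ M\<close>, independently of the graph.\<close>

lemma regularity_lemma:
  fixes \<epsilon> :: real
  assumes \<epsilon>: "\<epsilon> > 0"
  obtains M where "\<And>(V :: 'v set) E. finite V \<Longrightarrow>
    \<exists>\<S>. finite \<S> \<and> card \<S> \<le> M \<and> real (card (irregular V E \<epsilon> \<S>)) \<le> \<epsilon> * (real (card V))\<^sup>2"
proof -
  \<comment> \<open>One round turns \<open>m\<close> generating sets into at most
    \<open>m + 2 * 4 ^ m\<close>; \<open>M t\<close> iterates this \<open>t\<close> times from the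
    empty family.\<close>
  define M :: "nat \<Rightarrow> nat" where "M t = ((\<lambda>m. m + 2 * 4 ^ m) ^^ t) 0" for t
  have M_Suc: "M (Suc t) = M t + 2 * 4 ^ M t" for t by (simp add: M_def)
  obtain t :: nat where t: "real t > 1 / \<epsilon> ^ 5" using reals_Archimedean2 by blast
  \<comment> \<open>Within \<open>s\<close> rounds either a suitable family has appeared or every
    round has added its energy increment.\<close>
  have step: "\<exists>\<S>. finite \<S> \<and> card \<S> \<le> M s \<and>
      (real (card (irregular V E \<epsilon> \<S>)) \<le> \<epsilon> * (real (card V))\<^sup>2 \<or> energy V E \<S> \<ge> s * (\<epsilon> ^ 5 * (real (card V))\<^sup>2))"
    if V: "finite V" for V :: "'v set" and E s
  proof (induction s)
    case 0
    show ?case by (rule exI[of _ "{}"]) (simp add: energy_def sum_nonneg)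
  next
    case (Suc s)
    then obtain \<S> where \<S>: "finite \<S>" "card \<S> \<le> M s"
      "real (card (irregular V E \<epsilon> \<S>)) \<le> \<epsilon> * (real (card V))\<^sup>2 \<or> energy V E \<S> \<ge> s * (\<epsilon> ^ 5 * (real (card V))\<^sup>2)"
      by blast
    show ?case
    proof (cases "real (card (irregular V E \<epsilon> \<S>)) \<le> \<epsilon> * (real (card V))\<^sup>2")
      case True
      then show ?thesis using \<S> M_Suc[of s] by (metis le_add1 order.trans)
    next
      case False
      then obtain \<S>' where \<S>': "finite \<S>'" "card \<S>' \<le> card \<S> + 2 * 4 ^ card \<S>"
        "energy V E \<S>' \<ge> energy V E \<S> + \<epsilon> ^ 5 * (real (card V))\<^sup>2"
        using refine_irregular[OF V \<S>(1) \<epsilon>] by (metis not_le)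
      have "card \<S> + 2 * 4 ^ card \<S> \<le> M (Suc s)"
        unfolding M_Suc by (intro add_mono mult_le_mono power_increasing) (use \<S>(2) in auto)
      then have "card \<S>' \<le> M (Suc s)" using \<S>'(2) by simp
      moreover have "energy V E \<S>' \<ge> real (Suc s) * (\<epsilon> ^ 5 * (real (card V))\<^sup>2)"
        using \<S>(3) \<S>'(3) False by (simp add: algebra_simps)
      ultimately show ?thesis using \<S>'(1) by blast
    qed
  qed
  show ?thesis
  proof (rule that[of "M t"])
    fix V :: "'v set" and E
    assume V: "finite V"
    show "\<exists>\<S>. finite \<S> \<and> card \<S> \<le> M t \<and> real (card (irregular V E \<epsilon> \<S>)) \<le> \<epsilon> * (real (card V))\<^sup>2"
    proof (cases "V = {}")
      case True
      then show ?thesis by (intro exI[of _ "{}"]) (simp add: irregular_def)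
    next
      case False
      then have pos: "(real (card V))\<^sup>2 > 0" using V by simp
      have "t * (\<epsilon> ^ 5 * (real (card V))\<^sup>2) = (t * \<epsilon> ^ 5) * (real (card V))\<^sup>2" by simp
      also have "\<dots> > 1 * (real (card V))\<^sup>2"
        by (rule mult_strict_right_mono[OF _ pos]) (use t \<epsilon> in \<open>simp add: field_simps\<close>)
      finally have "\<not> energy V E \<S> \<ge> t * (\<epsilon> ^ 5 * (real (card V))\<^sup>2)" for \<S>
        using energy_le[OF V, of E \<S>] by simp
      then show ?thesis using step[OF V, of t E] by blast
    qed
  qed
qed

section \<open>Triangle removal\<close>

text \<open>Transitive triples of directed edges, not directed cycles: in a graph whose edges run
  upwards through three layers, each triangle is counted exactly once.\<close>

definition triangles :: "('v \<times> 'v) set \<Rightarrow> ('v \<times> 'v \<times> 'v) set" where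
  "triangles E = {(x, y, z). (x, y) \<in> E \<and> (y, z) \<in> E \<and> (x, z) \<in> E}"

text \<open>The density is at least \<open>2 * \<epsilon>\<close> and regularity costs at most
  \<open>\<epsilon>\<close> of it on large subsets.\<close>

lemma regular_pair_edges_ge:
  assumes "regular_pair E \<epsilon> U W" "edge_density E U W \<ge> 2 * \<epsilon>" "U' \<subseteq> U" "W' \<subseteq> W"
    "\<epsilon> * card U \<le> card U'" "\<epsilon> * card W \<le> card W'"
  shows "real (card (E \<inter> U' \<times> W')) \<ge> \<epsilon> * (real (card U') * real (card W'))"
proof -
  let ?p = "real (card U') * real (card W')"
  have "\<bar>real (card (E \<inter> U' \<times> W')) - edge_density E U W * ?p\<bar> \<le> \<epsilon> * ?p"
    using assms unfolding regular_pair_def by blast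
  moreover have "edge_density E U W * ?p \<ge> (2 * \<epsilon>) * ?p"
    by (rule mult_right_mono[OF assms(2)]) simp
  ultimately show ?thesis by linarith
qed

lemma card_Int_Times:
  assumes "finite X" "finite Y"
  shows "card (E \<inter> X \<times> Y) = (\<Sum>x\<in>X. card {y \<in> Y. (x, y) \<in> E})"
proof -
  have "E \<inter> X \<times> Y = (SIGMA x:X. {y \<in> Y. (x, y) \<in> E})" by auto
  then show ?thesis using assms by simp
qed

text \<open>Otherwise the low-degree vertices form a subset large enough for regularity, which
  forces more edges from it to \<open>Y\<close> than the degrees allow.\<close>

lemma few_low_degree:
  assumes fin: "finite X" "finite Y" and \<epsilon>: "0 < \<epsilon>" "\<epsilon> \<le> 1"
    and reg: "regular_pair E \<epsilon> X Y" "edge_density E X Y \<ge> 2 * \<epsilon>"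
  shows "real (card {x \<in> X. real (card {y \<in> Y. (x, y) \<in> E}) < \<epsilon> * card Y}) \<le> \<epsilon> * card X"
    (is "real (card ?B) \<le> _")
proof (rule ccontr)
  assume "\<not> ?thesis"
  then have large: "\<epsilon> * card X < card ?B" by simp
  have "\<epsilon> * card X \<ge> 0" using \<epsilon> by simp
  then have "?B \<noteq> {}" using large by fastforce
  have finB: "finite ?B" using fin by simp
  have "\<epsilon> * (real (card ?B) * real (card Y)) \<le> real (card (E \<inter> ?B \<times> Y))"
    by (rule regular_pair_edges_ge[OF reg]) (use large \<epsilon> in \<open>auto simp: mult_left_le_one_le\<close>)
  also have "\<dots> = (\<Sum>x\<in>?B. real (card {y \<in> Y. (x, y) \<in> E}))"
    using card_Int_Times[OF finB fin(2)] by simp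
  also have "\<dots> < (\<Sum>x\<in>?B. \<epsilon> * card Y)"
    by (rule sum_strict_mono) (use finB \<open>?B \<noteq> {}\<close> in auto)
  finally show False by (simp add: mult_ac)
qed

text \<open>A typical \<open>x\<close> has large neighbourhoods in \<open>Y\<close> and in
  \<open>Z\<close>, and regularity between \<open>Y\<close> and \<open>Z\<close> gives many edges
  between these neighbourhoods; each closes a triangle at \<open>x\<close>.\<close>

lemma triangle_counting:
  assumes fin: "finite X" "finite Y" "finite Z" and \<epsilon>: "0 < \<epsilon>" "\<epsilon> \<le> 1/4"
    and XY: "regular_pair E \<epsilon> X Y" "edge_density E X Y \<ge> 2 * \<epsilon>"
    and YZ: "regular_pair E \<epsilon> Y Z" "edge_density E Y Z \<ge> 2 * \<epsilon>"
    and XZ: "regular_pair E \<epsilon> X Z" "edge_density E X Z \<ge> 2 * \<epsilon>"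
  shows "real (card (triangles E \<inter> X \<times> Y \<times> Z)) \<ge> \<epsilon> ^ 3 / 2 * (real (card X) * real (card Y) * real (card Z))"
proof -
  define NY where "NY x = {y \<in> Y. (x, y) \<in> E}" for x
  define NZ where "NZ x = {z \<in> Z. (x, z) \<in> E}" for x
  define BY where "BY = {x \<in> X. real (card (NY x)) < \<epsilon> * card Y}"
  define BZ where "BZ = {x \<in> X. real (card (NZ x)) < \<epsilon> * card Z}"
  \<comment> \<open>Each exceptional set has at most \<open>\<epsilon> * card X\<close> elements, so
    \<open>\<epsilon> \<le> 1/4\<close> leaves half of \<open>X\<close>; this is the factor
    \<open>1/2\<close> in the bound.\<close>
  define X' where "X' = X - (BY \<union> BZ)"
  have B: "real (card BY) \<le> \<epsilon> * card X" "real (card BZ) \<le> \<epsilon> * card X"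
    unfolding BY_def BZ_def NY_def NZ_def 
    using few_low_degree[OF fin(1,2) \<epsilon>(1) _ XY] few_low_degree[OF fin(1,3) \<epsilon>(1) _ XZ] \<epsilon> by simp_all
  have "card X \<le> card (X' \<union> (BY \<union> BZ))"
    by (rule card_mono) (use fin in \<open>auto simp: X'_def BY_def BZ_def\<close>)
  also have "\<dots> \<le> card X' + (card BY + card BZ)"
    by (intro order.trans[OF card_Un_le] add_mono order.refl card_Un_le)
  finally have "real (card X') \<ge> card X - 2 * (\<epsilon> * card X)" using B by linarith
  moreover have "\<epsilon> * card X \<le> 1/4 * card X" using \<epsilon> by (intro mult_right_mono) auto
  ultimately have X': "real (card X') \<ge> 1/2 * card X" by linarith
  have edges: "real (card (E \<inter> NY x \<times> NZ x)) \<ge> \<epsilon> ^ 3 * (real (card Y) * real (card Z))" if "x \<in> X'" for x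
  proof -
    have deg: "\<epsilon> * card Y \<le> card (NY x)" "\<epsilon> * card Z \<le> card (NZ x)"
      using that by (auto simp: X'_def BY_def BZ_def)
    have "(\<epsilon> * card Y) * (\<epsilon> * card Z) \<le> real (card (NY x)) * real (card (NZ x))"
      by (rule mult_mono) (use deg \<epsilon> in auto)
    then have "\<epsilon> * ((\<epsilon> * card Y) * (\<epsilon> * card Z)) \<le> \<epsilon> * (real (card (NY x)) * real (card (NZ x)))"
      using \<epsilon> by (intro mult_left_mono) auto
    also have "\<dots> \<le> real (card (E \<inter> NY x \<times> NZ x))"
      by (rule regular_pair_edges_ge[OF YZ _ _ deg]) (auto simp: NY_def NZ_def)
    finally show ?thesis by (simp add: power3_eq_cube mult_ac)
  qed
  have "\<epsilon> ^ 3 / 2 * (real (card X) * real (card Y) * real (card Z))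
      = (1/2 * card X) * (\<epsilon> ^ 3 * (real (card Y) * real (card Z)))" by simp
  also have "\<dots> \<le> real (card X') * (\<epsilon> ^ 3 * (real (card Y) * real (card Z)))"
    by (rule mult_right_mono[OF X']) (use \<epsilon> in simp)
  also have "\<dots> \<le> (\<Sum>x\<in>X'. real (card (E \<inter> NY x \<times> NZ x)))"
    using sum_mono[OF edges] by simp
  also have "\<dots> = real (card (SIGMA x:X'. E \<inter> NY x \<times> NZ x))"
    using fin by (subst card_SigmaI) (auto simp: X'_def NY_def NZ_def)
  also have "\<dots> \<le> real (card (triangles E \<inter> X \<times> Y \<times> Z))"
    unfolding of_nat_le_iff
    by (rule card_mono) (use fin in \<open>auto simp: triangles_def X'_def NY_def NZ_def\<close>)
  finally show ?thesis .
qed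

text \<open>There are at most \<open>2 ^ card \<S>\<close> signatures, and each contributes at most
  \<open>a\<close> vertices.\<close>

lemma card_small_atoms:
  assumes V: "finite V" and S: "finite \<S>" and a: "a \<ge> 0"
  shows "real (card {x \<in> V. real (card (atom V \<S> x)) < a}) \<le> 2 ^ card \<S> * a"
proof -
  let ?B = "{x \<in> V. real (card (atom V \<S> x)) < a}"
  have finB: "finite ?B" using V by simp
  have "real (card ?B) = (\<Sum>l\<in>signature \<S> ` ?B. real (card {x \<in> ?B. signature \<S> x = l}))"
    using sum.image_gen[OF finB, of "\<lambda>_. 1::real" "signature \<S>"] by simp
  also have "\<dots> \<le> (\<Sum>l\<in>signature \<S> ` ?B. a)"
  proof (rule sum_mono)
    fix l assume "l \<in> signature \<S> ` ?B"
    then obtain x where x: "x \<in> ?B" "l = signature \<S> x" by blast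
    have "card {x \<in> ?B. signature \<S> x = l} \<le> card (atom V \<S> x)"
      by (rule card_mono) (use V x in \<open>auto simp: atom_def\<close>)
    then show "real (card {x \<in> ?B. signature \<S> x = l}) \<le> a" using x(1) by simp
  qed
  also have "\<dots> = real (card (signature \<S> ` ?B)) * a" by simp
  also have "\<dots> \<le> real (card (Pow \<S>)) * a"
    by (intro mult_right_mono of_nat_mono card_mono a) (use S in \<open>auto simp: signature_def\<close>)
  finally show ?thesis using S by (simp add: card_Pow)
qed

text \<open>The products of atoms partition \<open>V \<times> V\<close>, and in each sparse product
  at most the share \<open>a\<close> of the pairs are edges.\<close>

lemma card_sparse_edges:
  assumes V: "finite V" and a: "a \<ge> 0"
  shows "real (card {(x, y) \<in> E \<inter> V \<times> V. edge_density E (atom V \<S> x) (atom V \<S> y) < a}) \<le> a * (real (card V))\<^sup>2"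
proof -
  let ?c = "map_prod (signature \<S>) (signature \<S>)"
  let ?I = "{(x, y) \<in> V \<times> V. edge_density E (atom V \<S> x) (atom V \<S> y) < a}"
  have finI: "finite ?I" by (rule finite_subset[of _ "V \<times> V"]) (use V in auto)
  have fibre: "{\<omega> \<in> ?I. ?c \<omega> = p} = atom V \<S> x \<times> atom V \<S> y \<and> edge_density E (atom V \<S> x) (atom V \<S> y) < a"
    if "(x, y) \<in> ?I" "p = ?c (x, y)" for x y p
    using that by (auto simp: atom_def)
  have "{(x, y) \<in> E \<inter> V \<times> V. edge_density E (atom V \<S> x) (atom V \<S> y) < a} = ?I \<inter> {\<omega>. \<omega> \<in> E}" by auto
  then have "real (card {(x, y) \<in> E \<inter> V \<times> V. edge_density E (atom V \<S> x) (atom V \<S> y) < a})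
      = (\<Sum>\<omega>\<in>?I. of_bool (\<omega> \<in> E))"
    using finI by (simp only: sum_of_bool_eq)
  also have "\<dots> = (\<Sum>p\<in>?c ` ?I. \<Sum>\<omega> | \<omega> \<in> ?I \<and> ?c \<omega> = p. of_bool (\<omega> \<in> E))"
    by (rule sum.image_gen[OF finI])
  also have "\<dots> \<le> (\<Sum>p\<in>?c ` ?I. \<Sum>\<omega> | \<omega> \<in> ?I \<and> ?c \<omega> = p. a)"
  proof (rule sum_mono)
    fix p assume "p \<in> ?c ` ?I"
    then obtain x y where xy: "(x, y) \<in> ?I" "p = ?c (x, y)" by (metis (no_types, lifting) imageE surj_pair)
    let ?U = "atom V \<S> x" and ?W = "atom V \<S> y"
    have "finite ?U" "finite ?W" "?U \<noteq> {}" "?W \<noteq> {}" using xy V by (auto simp: atom_def)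
    then have "real (card ?U) * real (card ?W) > 0" "finite (?U \<times> ?W)" by (auto simp: card_gt_0_iff)
    then have "real (card (E \<inter> ?U \<times> ?W)) \<le> a * (real (card ?U) * real (card ?W))"
      using fibre[OF xy] by (simp add: edge_density_def divide_less_eq)
    then show "(\<Sum>\<omega> | \<omega> \<in> ?I \<and> ?c \<omega> = p. of_bool (\<omega> \<in> E)) \<le> (\<Sum>\<omega> | \<omega> \<in> ?I \<and> ?c \<omega> = p. a)"
      using fibre[OF xy] \<open>finite (?U \<times> ?W)\<close>
      by (simp add: sum_of_bool_eq card_cartesian_product Int_commute mult_ac)
  qed
  also have "\<dots> = (\<Sum>\<omega>\<in>?I. a)" by (rule sum.image_gen[OF finI, symmetric])
  also have "\<dots> = a * real (card ?I)" by simp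
  also have "\<dots> \<le> a * real (card (V \<times> V))"
    by (intro mult_left_mono of_nat_mono card_mono a) (use V in auto)
  finally show ?thesis by (simp add: card_cartesian_product power2_eq_square)
qed

text \<open>\<open>R\<close> consists of the edges over irregular pairs, sparse pairs or small
  atoms. A triangle surviving its removal lies over three large atoms that are pairwise regular and
  dense, and the counting lemma then gives too many triangles.\<close>

theorem triangle_removal:
  fixes \<epsilon> :: real
  assumes \<epsilon>: "\<epsilon> > 0"
  obtains \<delta> where "\<delta> > 0"
    "\<And>(V :: 'v set) E. \<lbrakk>finite V; E \<subseteq> V \<times> V; real (card (triangles E)) < \<delta> * real (card V) ^ 3\<rbrakk> \<Longrightarrow>
      \<exists>R\<subseteq>E. real (card R) \<le> \<epsilon> * (real (card V))\<^sup>2 \<and> triangles (E - R) = {}"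
proof -
  \<comment> \<open>Irregular pairs cost one unit \<open>e * (card V)\<^sup>2\<close>, sparse pairs
    two, and small atoms one for each end of the edge: five units in all. Triangle counting asks for
    \<open>e \<le> 1/4\<close>.\<close>
  define e where "e = min (\<epsilon> / 5) (1/4)"
  have e: "0 < e" "e \<le> 1/4" "5 * e \<le> \<epsilon>" using \<epsilon> by (auto simp: e_def)
  obtain M where M: "\<And>(V :: 'v set) E. finite V \<Longrightarrow>
    \<exists>\<S>. finite \<S> \<and> card \<S> \<le> M \<and> real (card (irregular V E e \<S>)) \<le> e * (real (card V))\<^sup>2"
    using regularity_lemma[OF e(1)] by blast
  \<comment> \<open>The factor from triangle counting, times the least share
    \<open>e / 2 ^ M\<close> of the vertices for each of three atoms that are not small.\<close>
  define \<delta> where "\<delta> = e ^ 3 / 2 * (e / 2 ^ M) ^ 3"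
  show ?thesis
  proof (rule that[of \<delta>])
    show "\<delta> > 0" using e by (simp add: \<delta>_def)
    fix V :: "'v set" and E
    assume V: "finite V" and E: "E \<subseteq> V \<times> V" and few: "real (card (triangles E)) < \<delta> * real (card V) ^ 3"
    let ?n = "real (card V)"
    obtain \<S> where \<S>: "finite \<S>" "card \<S> \<le> M" and irr: "real (card (irregular V E e \<S>)) \<le> e * ?n\<^sup>2"
      using M[OF V] by blast
    define small where "small = {x \<in> V. real (card (atom V \<S> x)) < e * ?n / 2 ^ M}"
    define sparse where "sparse = {(x, y) \<in> E \<inter> V \<times> V. edge_density E (atom V \<S> x) (atom V \<S> y) < 2 * e}"
    define R where "R = E \<inter> (irregular V E e \<S> \<union> sparse \<union> small \<times> V \<union> V \<times> small)"
    have "real (card small) \<le> 2 ^ card \<S> * (e * ?n / 2 ^ M)"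
      unfolding small_def by (rule card_small_atoms) (use V \<S> e in auto)
    also have "\<dots> \<le> 2 ^ M * (e * ?n / 2 ^ M)"
      by (intro mult_right_mono power_increasing) (use \<S> e in auto)
    finally have "real (card small) * ?n \<le> (e * ?n) * ?n" by (intro mult_right_mono) auto
    then have small: "real (card small) * ?n \<le> e * ?n\<^sup>2" by (simp add: power2_eq_square mult_ac)
    have sparse: "real (card sparse) \<le> 2 * e * ?n\<^sup>2"
      unfolding sparse_def by (rule card_sparse_edges) (use V e in auto)
    have "finite (irregular V E e \<S>)" "finite sparse" "finite small"
      using V by (auto simp: irregular_def sparse_def small_def intro: finite_subset[of _ "V \<times> V"])
    then have "card R \<le> card (irregular V E e \<S> \<union> sparse \<union> small \<times> V \<union> V \<times> small)"
      unfolding R_def using V by (intro card_mono) auto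
    also have "\<dots> \<le> card (irregular V E e \<S>) + card sparse + card (small \<times> V) + card (V \<times> small)"
      by (intro order.trans[OF card_Un_le] add_mono order.refl)
    finally have "real (card R) \<le> real (card (irregular V E e \<S>)) + real (card sparse) + 2 * (real (card small) * ?n)"
      by (simp add: card_cartesian_product mult_ac flip: of_nat_add of_nat_mult)
    also have "\<dots> \<le> 5 * e * ?n\<^sup>2" using irr sparse small by simp
    also have "\<dots> \<le> \<epsilon> * ?n\<^sup>2" by (rule mult_right_mono[OF e(3)]) simp
    finally have R: "real (card R) \<le> \<epsilon> * ?n\<^sup>2" .
    have "triangles (E - R) = {}"
    proof (rule ccontr)
      assume "triangles (E - R) \<noteq> {}"
      then obtain x y z where xyz: "(x, y) \<in> E - R" "(y, z) \<in> E - R" "(x, z) \<in> E - R"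
        by (auto simp: triangles_def)
      let ?A = "atom V \<S>"
      have good: "regular_pair E e (?A u) (?A v)" "edge_density E (?A u) (?A v) \<ge> 2 * e"
        "real (card (?A u)) \<ge> e * ?n / 2 ^ M" "real (card (?A v)) \<ge> e * ?n / 2 ^ M"
        if "(u, v) \<in> E - R" for u v
        using that E by (auto simp: R_def irregular_def sparse_def small_def not_less)
      have finA: "finite (?A u)" for u using V by (simp add: atom_def)
      have "\<delta> * ?n ^ 3 = e ^ 3 / 2 * ((e * ?n / 2 ^ M) * (e * ?n / 2 ^ M) * (e * ?n / 2 ^ M))"
        by (simp add: \<delta>_def power3_eq_cube)
      also have "\<dots> \<le> e ^ 3 / 2 * (real (card (?A x)) * real (card (?A y)) * real (card (?A z)))"
        using good[OF xyz(1)] good[OF xyz(3)] e by (intro mult_left_mono mult_mono) auto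
      also have "\<dots> \<le> real (card (triangles E \<inter> ?A x \<times> ?A y \<times> ?A z))"
        by (rule triangle_counting) (use finA e good xyz in auto)
      also have "\<dots> \<le> real (card (triangles E))"
      proof -
        have "triangles E \<subseteq> V \<times> V \<times> V" using E by (auto simp: triangles_def)
        then have "finite (triangles E)" using V by (auto intro: finite_subset)
        then show ?thesis by (simp add: card_mono)
      qed
      finally show False using few by simp
    qed
    then show "\<exists>R\<subseteq>E. real (card R) \<le> \<epsilon> * ?n\<^sup>2 \<and> triangles (E - R) = {}"
      using R by (intro exI[of _ R]) (auto simp: R_def)
  qed
qed

section \<open>Sets of small tripling\<close>

context group
begin

section \<open>Ruzsa's triangle inequality\<close>

lemma finite_set_mult: "\<lbrakk>finite X; finite Y\<rbrakk> \<Longrightarrow> finite (X <#> Y)"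
  by (auto simp: set_mult_def)

text \<open>Fix a factorisation \<open>p = u \<otimes> v\<close> of every \<open>p\<close> in
  \<open>U <#> V\<close> and send \<open>(p, w)\<close> to
  \<open>(u \<otimes> w, inv w \<otimes> v)\<close>. The product of the two components is
  \<open>p\<close>, which determines \<open>u\<close> and then \<open>w\<close>, so the map is
  injective.\<close>

lemma ruzsa_triangle:
  assumes fin: "finite U" "finite V" "finite W"
    and G: "U \<subseteq> carrier G" "V \<subseteq> carrier G" "W \<subseteq> carrier G"
  shows "card (U <#> V) * card W \<le> card (U <#> W) * card (set_inv W <#> V)"
proof -
  have "\<forall>p\<in>U <#> V. \<exists>q. fst q \<in> U \<and> snd q \<in> V \<and> p = fst q \<otimes> snd q"
    by (auto simp: set_mult_def)
  then obtain q where q: "\<forall>p\<in>U <#> V. fst (q p) \<in> U \<and> snd (q p) \<in> V \<and> p = fst (q p) \<otimes> snd (q p)"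
    using bchoice by meson
  define F where "F = (\<lambda>(p, w). (fst (q p) \<otimes> w, inv w \<otimes> snd (q p)))"
  have prod: "(fst (q p) \<otimes> w) \<otimes> (inv w \<otimes> snd (q p)) = p" if "p \<in> U <#> V" "w \<in> W" for p w
  proof -
    have *: "fst (q p) \<in> carrier G" "snd (q p) \<in> carrier G" "w \<in> carrier G" "p = fst (q p) \<otimes> snd (q p)"
      using q that G by auto
    then have "(fst (q p) \<otimes> w) \<otimes> (inv w \<otimes> snd (q p)) = fst (q p) \<otimes> snd (q p)"
      by (simp add: m_assoc inv_solve_left flip: m_assoc[of w])
    then show ?thesis using *(4) by simp
  qed
  have "inj_on F ((U <#> V) \<times> W)"
  proof (rule inj_onI, clarify)
    fix p w p' w'
    assume pw: "p \<in> U <#> V" "w \<in> W" "p' \<in> U <#> V" "w' \<in> W" and eq: "F (p, w) = F (p', w')"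
    have "p = p'" using prod[of p w] prod[of p' w'] pw eq by (simp add: F_def)
    moreover have "fst (q p) \<in> carrier G" "w \<in> carrier G" "w' \<in> carrier G" using q pw G by auto
    ultimately show "p = p' \<and> w = w'" using pw eq G by (auto simp: F_def)
  qed
  moreover have "F ` ((U <#> V) \<times> W) \<subseteq> (U <#> W) \<times> (set_inv W <#> V)"
    using q by (fastforce simp: F_def set_mult_def SET_INV_def)
  moreover have "finite ((U <#> W) \<times> (set_inv W <#> V))"
    using fin by (auto simp: SET_INV_def intro!: finite_set_mult)
  ultimately have "card ((U <#> V) \<times> W) \<le> card ((U <#> W) \<times> (set_inv W <#> V))"
    by (rule card_inj_on_le)
  then show ?thesis by (simp add: card_cartesian_product)
qed

text \<open>The form used for iteration, with \<open>W\<close> as pivot. The lower bound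
  \<open>a\<close> is kept apart from \<open>card W\<close> so that sizes can be measured in
  multiples of \<open>card A\<close> when the pivot is larger.\<close>

lemma ruzsa_triangle_bound:
  fixes a s t :: real
  assumes fin: "finite U" "finite V" "finite W"
    and G: "U \<subseteq> carrier G" "V \<subseteq> carrier G" "W \<subseteq> carrier G"
    and a: "0 < a" "a \<le> card W" and s: "card (U <#> W) \<le> s" and t: "card (set_inv W <#> V) \<le> t * a" "t \<ge> 0"
  shows "card (U <#> V) \<le> s * t"
proof -
  have "card (U <#> V) * a \<le> card (U <#> V) * real (card W)"
    using a by (intro mult_left_mono) auto
  also have "\<dots> \<le> real (card (U <#> W)) * card (set_inv W <#> V)"
    using ruzsa_triangle[OF fin G] by (metis of_nat_le_iff of_nat_mult)
  also have "\<dots> \<le> s * (t * a)"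
    using s t by (intro mult_mono) (auto intro: order.trans[OF of_nat_0_le_iff])
  finally show ?thesis using a by simp
qed

section \<open>Triple products with arbitrary signs\<close>

lemma set_inv_set_mult:
  assumes "X \<subseteq> carrier G" "Y \<subseteq> carrier G"
  shows "set_inv (X <#> Y) = set_inv Y <#> set_inv X"
proof -
  have "inv (x \<otimes> y) = inv y \<otimes> inv x" if "x \<in> X" "y \<in> Y" for x y
    using that assms by (auto intro: inv_mult_group)
  then show ?thesis unfolding SET_INV_def set_mult_def by auto
qed

lemma set_inv_set_inv: "X \<subseteq> carrier G \<Longrightarrow> set_inv (set_inv X) = X"
  by (force simp: SET_INV_def)

lemma set_inv_subset_carrier: "X \<subseteq> carrier G \<Longrightarrow> set_inv X \<subseteq> carrier G"
  by (auto simp: SET_INV_def)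

lemma card_set_inv:
  assumes "X \<subseteq> carrier G"
  shows "card (set_inv X) = card X"
proof -
  have "set_inv X = m_inv G ` X" by (auto simp: SET_INV_def)
  moreover have "inj_on (m_inv G) X" using assms inv_inj inj_on_subset by blast
  ultimately show ?thesis by (simp add: card_image)
qed

lemma card_le_card_set_mult:
  assumes "finite X" "finite Z" "X \<subseteq> carrier G" "Z \<subseteq> carrier G" "Z \<noteq> {}"
  shows "card X \<le> card (X <#> Z)"
proof -
  obtain z where z: "z \<in> Z" using assms by auto
  show ?thesis
    by (rule card_inj_on_le[of "\<lambda>x. x \<otimes> z"])
      (use z assms in \<open>auto simp: set_mult_def inj_on_def subset_iff\<close>)
qed

lemma set_mult_one: "X \<subseteq> carrier G \<Longrightarrow> X <#> {\<one>} = X" "X \<subseteq> carrier G \<Longrightarrow> {\<one>} <#> X = X"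
  by (auto simp: set_mult_def subset_iff)

text \<open>Ruzsa's inequality changes signs at the cost of factors \<open>K\<close>, and inversion
  maps a sign pattern to the reversed opposite one. Products with a factor \<open>{\<one>}\<close>
  are shorter words and no larger.\<close>

lemma card_triple_product_signs:
  fixes K :: real
  assumes A: "finite A" "A \<subseteq> carrier G" "A \<noteq> {}" and K: "K \<ge> 1"
    and tripling: "real (card (A <#> A <#> A)) \<le> K * card A"
    and X: "X \<in> {A, set_inv A, {\<one>}}" and Y: "Y \<in> {A, set_inv A, {\<one>}}" and Z: "Z \<in> {A, set_inv A, {\<one>}}"
  shows "real (card (X <#> Y <#> Z)) \<le> K ^ 3 * card A"
proof -
  let ?a = "real (card A)"
  define I where "I = set_inv A"
  have a: "?a \<ge> 1" using A by (simp add: Suc_leI card_gt_0_iff)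
  have finI: "finite I" and IG: "I \<subseteq> carrier G" and cardI: "card I = card A" and II: "set_inv I = A"
    and I0: "I \<noteq> {}"
    unfolding I_def using A set_inv_subset_carrier card_set_inv set_inv_set_inv by (auto simp: SET_INV_def)
  note [simp] = finI IG A cardI II I0 finite_set_mult set_mult_closed set_inv_set_mult set_inv_subset_carrier
  have [simp]: "set_inv A = I" by (simp add: I_def)
  note assoc = set_mult_assoc[symmetric]
  have inv3: "card (P <#> Q <#> R) = card (set_inv R <#> (set_inv Q <#> set_inv P))"
    if "P \<subseteq> carrier G" "Q \<subseteq> carrier G" "R \<subseteq> carrier G" for P Q R
    using that card_set_inv[of "P <#> Q <#> R"] by simp
  have K12: "K \<le> K ^ 3" "K ^ 2 \<le> K ^ 3" "1 \<le> K ^ 3"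
    using K power_increasing[of 1 3 K] power_increasing[of 2 3 K] power_increasing[of 0 3 K] by simp_all
  have "K * ?a \<le> K ^ 3 * ?a" "K ^ 2 * ?a \<le> K ^ 3 * ?a" "1 * ?a \<le> K ^ 3 * ?a"
    by (intro mult_right_mono K12; simp)+
  then have K_mono: "r \<le> K ^ 3 * ?a" if "r \<le> K * ?a \<or> r \<le> K ^ 2 * ?a \<or> r \<le> ?a" for r
    using that by linarith
  have AAA: "card (A <#> A <#> A) \<le> K * ?a" using tripling .
  have AA: "card (A <#> A) \<le> K * ?a"
    using card_le_card_set_mult[of "A <#> A" A] AAA by simp
  have II': "card (I <#> I) \<le> K * ?a"
    using AA card_set_inv[of "A <#> A"] by simp
  have III: "card (I <#> I <#> I) \<le> K * ?a"
    using inv3[of I I I] AAA by (simp add: assoc[of A A A])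
  \<comment> \<open>With pivot \<open>A\<close> the two factors are \<open>A <#> A <#> A\<close> and
    \<open>I <#> I\<close>, each bounded by \<open>K * ?a\<close>.\<close>
  have AAI: "card (A <#> A <#> I) \<le> K ^ 2 * ?a"
    using ruzsa_triangle_bound[of "A <#> A" I A ?a "K * ?a" K] AAA II' a K by (simp add: power2_eq_square mult_ac)
  have AII: "card (A <#> I <#> I) \<le> K ^ 2 * ?a"
    using inv3[of A I I] AAI by (simp add: assoc[of A A I])
  have IAA: "card (I <#> A <#> A) \<le> K ^ 2 * ?a"
    using ruzsa_triangle_bound[of I "A <#> A" I ?a "K * ?a" K] AAA II' a K
    by (simp add: power2_eq_square mult_ac assoc)
  have IIA: "card (I <#> I <#> A) \<le> K ^ 2 * ?a"
    using inv3[of I I A] IAA by (simp add: assoc)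
  \<comment> \<open>For alternating signs one of the two factors is a mixed triple product that
    already costs \<open>K ^ 2\<close>; hence the cube.\<close>
  have AIA: "card (A <#> I <#> A) \<le> K ^ 3 * ?a"
    using ruzsa_triangle_bound[of A "I <#> A" A ?a "K * ?a" "K ^ 2"] AA IIA a K
    by (simp add: power2_eq_square power3_eq_cube mult_ac assoc)
  have IAI: "card (I <#> A <#> I) \<le> K ^ 3 * ?a"
    using ruzsa_triangle_bound[of I "A <#> I" I ?a "K * ?a" "K ^ 2"] II' AAI a K
    by (simp add: power2_eq_square power3_eq_cube mult_ac assoc)
  have triple: "card (P <#> Q <#> R) \<le> K ^ 3 * ?a" if "P \<in> {A, I}" "Q \<in> {A, I}" "R \<in> {A, I}" for P Q R
    using that AAA III AAI AII IAA IIA AIA IAI K_mono by auto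
  have double: "card (P <#> Q) \<le> K ^ 3 * ?a" if "P \<in> {A, I}" "Q \<in> {A, I}" for P Q
  proof -
    have "P \<subseteq> carrier G" "Q \<subseteq> carrier G" "finite P" "finite Q" using that A IG finI by blast+
    then have "card (P <#> Q) \<le> card (P <#> Q <#> A)"
      by (intro card_le_card_set_mult) simp_all
    then show ?thesis using triple[of P Q A] that by simp
  qed
  have single: "card P \<le> K ^ 3 * ?a" if "P \<in> {A, I}" for P
    using that K_mono[of ?a] by auto
  have one: "1 \<le> K ^ 3 * ?a" by (intro K_mono) (use a in simp)
  show ?thesis
    using X Y Z by (elim insertE emptyE; simp add: set_mult_one triple double single one)
qed

section \<open>Growth of symmetric product sets\<close>

lemma sym_closure_subset_carrier: "A \<subseteq> carrier G \<Longrightarrow> sym_closure G A \<subseteq> carrier G"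
  unfolding sym_closure_def using set_inv_subset_carrier by auto

lemma sym_prod_subset_carrier: "A \<subseteq> carrier G \<Longrightarrow> sym_prod G A n \<subseteq> carrier G"
  by (induction n) (simp_all add: set_mult_closed sym_closure_subset_carrier)

lemma finite_sym_closure: "finite A \<Longrightarrow> finite (sym_closure G A)"
  by (simp add: sym_closure_def SET_INV_def)

lemma finite_sym_prod: "finite A \<Longrightarrow> finite (sym_prod G A n)"
  by (induction n) (simp_all add: finite_set_mult finite_sym_closure)

lemma sym_prod_1: "A \<subseteq> carrier G \<Longrightarrow> sym_prod G A (Suc 0) = sym_closure G A"
  by (simp add: set_mult_one sym_closure_subset_carrier)

lemma sym_prod_add:
  assumes "A \<subseteq> carrier G"
  shows "sym_prod G A (i + j) = sym_prod G A i <#> sym_prod G A j"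
  by (induction j)
    (use assms in \<open>simp_all add: set_mult_one sym_prod_subset_carrier sym_closure_subset_carrier set_mult_assoc\<close>)

lemma sym_prod_mono:
  assumes "A \<subseteq> carrier G"
  shows "sym_prod G A i \<subseteq> sym_prod G A (i + j)"
proof (induction j)
  case (Suc j)
  have "x \<in> sym_prod G A (Suc n)" if "x \<in> sym_prod G A n" for x n
  proof -
    have "x \<otimes> \<one> \<in> sym_prod G A (Suc n)"
      using that by (auto simp: set_mult_def sym_closure_def)
    then show ?thesis using that sym_prod_subset_carrier[OF assms, of n] by auto
  qed
  then show ?case using Suc by auto
qed simp

lemma set_inv_sym_closure:
  assumes "A \<subseteq> carrier G"
  shows "set_inv (sym_closure G A) = sym_closure G A"
proof -
  have "set_inv (sym_closure G A) = set_inv A \<union> set_inv (set_inv A) \<union> {\<one>}"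
    by (auto simp: sym_closure_def SET_INV_def)
  then show ?thesis using assms by (auto simp: set_inv_set_inv sym_closure_def)
qed

text \<open>The symmetric closure \<open>B\<close> again has small tripling, and Ruzsa's inequality
  with pivot \<open>B\<close> adds one factor \<open>B\<close> at the cost of one constant.\<close>

lemma card_sym_prod_le:
  fixes K :: real
  assumes A: "finite A" "A \<subseteq> carrier G" "A \<noteq> {}" and K: "K \<ge> 1"
    and tripling: "real (card (A <#> A <#> A)) \<le> K * card A"
  shows "real (card (sym_prod G A n)) \<le> (27 * K ^ 3) ^ Suc n * card A"
proof -
  define B where "B = sym_closure G A"
  define D where "D = 27 * K ^ 3"
  have BG: "B \<subseteq> carrier G" and finB: "finite B" and invB: "set_inv B = B"
    using A by (simp_all add: B_def sym_closure_subset_carrier finite_sym_closure set_inv_sym_closure)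
  have D: "D \<ge> 0" using K by (simp add: D_def)
  have AB: "card A \<le> card B" by (rule card_mono[OF finB]) (auto simp: B_def sym_closure_def)
  have a: "real (card A) > 0" using A by (simp add: card_gt_0_iff)
  \<comment> \<open>The triple product of \<open>B\<close> distributes into at most 27 products of
    members of \<open>\<C>\<close>, all covered by the bound for signed triples.\<close>
  define \<C> where "\<C> = {A, set_inv A, {\<one>}}"
  have "B = \<Union> \<C>" by (auto simp: B_def \<C>_def sym_closure_def)
  then have "B <#> B <#> B = (\<Union>(X, Y, Z)\<in>\<C> \<times> \<C> \<times> \<C>. X <#> Y <#> Z)"
    by (auto simp: set_mult_def) blast
  moreover have fin\<C>: "finite \<C>" by (simp add: \<C>_def)
  ultimately have "card (B <#> B <#> B) \<le> (\<Sum>(X, Y, Z)\<in>\<C> \<times> \<C> \<times> \<C>. card (X <#> Y <#> Z))"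
    using card_UN_le[of "\<C> \<times> \<C> \<times> \<C>" "\<lambda>(X, Y, Z). X <#> Y <#> Z"] by (simp add: case_prod_unfold)
  then have "real (card (B <#> B <#> B)) \<le> (\<Sum>(X, Y, Z)\<in>\<C> \<times> \<C> \<times> \<C>. real (card (X <#> Y <#> Z)))"
    by (simp add: case_prod_unfold flip: of_nat_sum)
  also have "\<dots> \<le> (\<Sum>(X, Y, Z)\<in>\<C> \<times> \<C> \<times> \<C>. K ^ 3 * card A)"
    by (rule sum_mono) (use card_triple_product_signs[OF A K tripling] in \<open>auto simp: \<C>_def\<close>)
  also have "\<dots> = real (card \<C> * card \<C> * card \<C>) * (K ^ 3 * card A)"
    by (simp add: case_prod_unfold card_cartesian_product)
  also have "\<dots> \<le> 27 * (K ^ 3 * card A)"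
  proof (rule mult_right_mono)
    have "card \<C> \<le> 3" by (simp add: \<C>_def card_insert_if)
    then have "card \<C> * card \<C> * card \<C> \<le> 3 * 3 * 3" by (intro mult_le_mono)
    then show "real (card \<C> * card \<C> * card \<C>) \<le> 27" by linarith
  qed (use K in simp)
  finally have BBB: "real (card (B <#> B <#> B)) \<le> D * card A" by (simp add: D_def)
  \<comment> \<open>The induction starts at the triple product; the shift by 3 is undone at the end
    by monotonicity of the symmetric products.\<close>
  have step: "real (card (sym_prod G A (n + 3))) \<le> D ^ Suc n * card A" for n
  proof (induction n)
    case 0
    have "sym_prod G A 3 = B <#> B <#> B"
      using A by (simp add: eval_nat_numeral B_def set_mult_one sym_closure_subset_carrier)
    then show ?case using BBB by simp
  next
    case (Suc n)
    let ?U = "sym_prod G A (n + 2)"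
    have U: "finite ?U" "?U \<subseteq> carrier G" by (rule finite_sym_prod[OF A(1)], rule sym_prod_subset_carrier[OF A(2)])
    have "sym_prod G A (Suc n + 3) = ?U <#> (B <#> B)"
      using A BG U(2) by (simp add: eval_nat_numeral B_def set_mult_assoc set_mult_closed
          sym_prod_subset_carrier sym_closure_subset_carrier)
    moreover have "real (card (?U <#> (B <#> B))) \<le> (D ^ Suc n * card A) * D"
    \<comment> \<open>As \<open>B\<close> is its own inverse set, the second factor is the triple
      product of \<open>B\<close>, while the first is bounded by the induction hypothesis.\<close>
    proof (rule ruzsa_triangle_bound[of _ _ B "card A"])
      have "?U <#> B = sym_prod G A (n + 3)" by (simp add: eval_nat_numeral B_def)
      then show "real (card (?U <#> B)) \<le> D ^ Suc n * card A" using Suc by simp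
      show "real (card (set_inv B <#> (B <#> B))) \<le> D * card A"
        using BBB BG by (simp add: invB set_mult_assoc)
    qed (use U BG finB AB D a in \<open>auto simp: finite_set_mult set_mult_closed\<close>)
    ultimately show ?case by (simp add: mult_ac)
  qed
  have "card (sym_prod G A n) \<le> card (sym_prod G A (n + 3))"
    by (rule card_mono[OF finite_sym_prod[OF A(1)] sym_prod_mono[OF A(2)]])
  then show ?thesis using step[of n] by (simp add: D_def)
qed

text \<open>The generated subgroup is contained in the union of the finite sets
  \<open>sym_prod G A n\<close>.\<close>

lemma countable_generate:
  assumes A: "finite A" "A \<subseteq> carrier G"
  shows "countable (generate G A)"
proof -
  let ?U = "\<Union>n. sym_prod G A n"
  have "x \<in> ?U" if "x \<in> generate G A" for x
    using that
  proof (induction rule: generate.induct)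
    case one
    have "\<one> \<in> sym_prod G A 0" by simp
    then show ?case by blast
  next
    case (incl h)
    then have "h \<in> sym_prod G A (Suc 0)" unfolding sym_prod_1[OF A(2)] by (simp add: sym_closure_def)
    then show ?case by blast
  next
    case (inv h)
    then have "inv h \<in> sym_prod G A (Suc 0)" unfolding sym_prod_1[OF A(2)] by (auto simp: sym_closure_def SET_INV_def)
    then show ?case by blast
  next
    case (eng h1 h2)
    then obtain i j where "h1 \<in> sym_prod G A i" "h2 \<in> sym_prod G A j" by blast
    then have "h1 \<otimes> h2 \<in> sym_prod G A (i + j)" unfolding sym_prod_add[OF A(2)] by (auto simp: set_mult_def)
    then show ?case by blast
  qed
  moreover have "countable ?U" using A finite_sym_prod by (blast intro: countable_UN countable_finite)
  ultimately show ?thesis by (meson countable_subset subsetI)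
qed

end

section \<open>Counting solutions\<close>

text \<open>The natural number marks the copy of \<open>P\<close>. Edges run from a lower to a
  higher mark, so the marks of a triangle are 0, 1, 2 in this order.\<close>

definition solution_graph ::
  "('a, 'b) monoid_scheme \<Rightarrow> 'a set \<Rightarrow> 'a set \<Rightarrow> 'a set \<Rightarrow> 'a set \<Rightarrow> (('a \<times> nat) \<times> ('a \<times> nat)) set" where
  "solution_graph G P S1 S2 S3 = {((x, i), (y, j)). x \<in> P \<and> y \<in> P \<and>
     (i = 0 \<and> j = 1 \<and> inv\<^bsub>G\<^esub> x \<otimes>\<^bsub>G\<^esub> y \<in> S1 \<or>
      i = 1 \<and> j = 2 \<and> inv\<^bsub>G\<^esub> x \<otimes>\<^bsub>G\<^esub> y \<in> S2 \<or>
      i = 0 \<and> j = 2 \<and> inv\<^bsub>G\<^esub> x \<otimes>\<^bsub>G\<^esub> y \<in> S3)}"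

context group
begin

section \<open>Triangles of the solution graph\<close>

lemma inv_mult_cancel: "\<lbrakk>x \<in> carrier G; y \<in> carrier G\<rbrakk> \<Longrightarrow> inv x \<otimes> (x \<otimes> y) = y"
  using m_assoc[of "inv x" x y] by simp

lemma mult_inv_cancel: "\<lbrakk>x \<in> carrier G; y \<in> carrier G\<rbrakk> \<Longrightarrow> x \<otimes> (inv x \<otimes> y) = y"
  using m_assoc[of x "inv x" y] by simp

text \<open>A triangle is determined by its first vertex and its edge labels, and the labels form a
  solution because \<open>inv x \<otimes> y \<otimes> (inv y \<otimes> z) = inv x \<otimes>
  z\<close>.\<close>

lemma card_triangles_solution_graph_le:
  assumes P: "finite P" "P \<subseteq> carrier G" and S: "finite S1" "finite S2" "finite S3"
  shows "card (triangles (solution_graph G P S1 S2 S3))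
    \<le> card P * card {(s1, s2, s3). s1 \<in> S1 \<and> s2 \<in> S2 \<and> s3 \<in> S3 \<and> s1 \<otimes> s2 = s3}"
proof -
  let ?T = "triangles (solution_graph G P S1 S2 S3)"
  let ?S = "{(s1, s2, s3). s1 \<in> S1 \<and> s2 \<in> S2 \<and> s3 \<in> S3 \<and> s1 \<otimes> s2 = s3}"
  define F where "F = (\<lambda>((x, i::nat), (y, j::nat), (z, l::nat)). (x, inv x \<otimes> y, inv y \<otimes> z, inv x \<otimes> z))"
  have T: "\<exists>x y z. t = ((x, 0), (y, 1), (z, 2)) \<and> x \<in> P \<and> y \<in> P \<and> z \<in> P \<and>
      inv x \<otimes> y \<in> S1 \<and> inv y \<otimes> z \<in> S2 \<and> inv x \<otimes> z \<in> S3" if "t \<in> ?T" for t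
  proof -
    obtain x i y j z l where t: "t = ((x, i), (y, j), (z, l))" by (metis surj_pair)
    have "x \<in> P" "y \<in> P" "z \<in> P"
      and ij: "i = 0 \<and> j = 1 \<and> inv x \<otimes> y \<in> S1 \<or>
          i = 1 \<and> j = 2 \<and> inv x \<otimes> y \<in> S2 \<or> i = 0 \<and> j = 2 \<and> inv x \<otimes> y \<in> S3"
      and jl: "j = 0 \<and> l = 1 \<and> inv y \<otimes> z \<in> S1 \<or>
          j = 1 \<and> l = 2 \<and> inv y \<otimes> z \<in> S2 \<or> j = 0 \<and> l = 2 \<and> inv y \<otimes> z \<in> S3"
      and il: "i = 0 \<and> l = 1 \<and> inv x \<otimes> z \<in> S1 \<or>
          i = 1 \<and> l = 2 \<and> inv x \<otimes> z \<in> S2 \<or> i = 0 \<and> l = 2 \<and> inv x \<otimes> z \<in> S3"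
      using that unfolding t triangles_def solution_graph_def by simp_all
    moreover have "i = 0" "j = 1" "l = 2" using ij jl by auto
    ultimately show ?thesis using t by simp
  qed
  have "finite ?S" by (rule finite_subset[of _ "S1 \<times> S2 \<times> S3"]) (use S in auto)
  then have fin: "finite (P \<times> ?S)" using P by simp
  have cancel: "y = y'" if "inv x \<otimes> y = inv x \<otimes> y'" "x \<in> P" "y \<in> P" "y' \<in> P" for x y y'
  proof -
    have "x \<in> carrier G" "y \<in> carrier G" "y' \<in> carrier G" using that P by auto
    then show ?thesis using that(1) by simp
  qed
  have "inj_on F ?T"
  proof (rule inj_onI)
    fix t t' assume t: "t \<in> ?T" "t' \<in> ?T" and eq: "F t = F t'"
    obtain x y z where xyz: "t = ((x, 0), (y, 1), (z, 2))" "x \<in> P" "y \<in> P" "z \<in> P" using T[OF t(1)] by blast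
    obtain x' y' z' where xyz': "t' = ((x', 0), (y', 1), (z', 2))" "x' \<in> P" "y' \<in> P" "z' \<in> P"
      using T[OF t(2)] by blast
    have eqs: "x' = x" "inv x \<otimes> y = inv x \<otimes> y'" "inv x \<otimes> z = inv x \<otimes> z'"
      using eq by (auto simp: F_def xyz(1) xyz'(1))
    have "y = y'" "z = z'" using cancel eqs xyz xyz' by blast+
    then show "t = t'" using xyz(1) xyz'(1) eqs(1) by simp
  qed
  moreover have "F ` ?T \<subseteq> P \<times> ?S"
  proof
    fix u assume "u \<in> F ` ?T"
    then obtain t where t: "t \<in> ?T" "u = F t" by blast
    obtain x y z where xyz: "t = ((x, 0), (y, 1), (z, 2))" "x \<in> P" "y \<in> P" "z \<in> P"
      "inv x \<otimes> y \<in> S1" "inv y \<otimes> z \<in> S2" "inv x \<otimes> z \<in> S3"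
      using T[OF t(1)] by blast
    then have "x \<in> carrier G" "y \<in> carrier G" "z \<in> carrier G" using P by auto
    then have "inv x \<otimes> y \<otimes> (inv y \<otimes> z) = inv x \<otimes> z"
      by (simp add: m_assoc mult_inv_cancel)
    then show "u \<in> P \<times> ?S" using xyz t(2) by (simp add: F_def)
  qed
  ultimately have "card ?T \<le> card (P \<times> ?S)" using fin by (rule card_inj_on_le)
  then show ?thesis by (simp only: card_cartesian_product)
qed

text \<open>Every \<open>(x, a)\<close> in \<open>A \<times> A\<close> spans a triangle, one of
  whose edges \<open>e1 x a\<close>, \<open>e2 x a\<close>, \<open>e3 x a\<close> must lie in
  \<open>R\<close>; conversely an edge belongs to at most \<open>k\<close> of these
  triangles.\<close>

lemma card_square_le_edge_cover:
  assumes A: "finite A" "A \<subseteq> P" and P: "finite P" "P \<subseteq> carrier G"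
    and fib: "fibers_bounded A f1 k" "fibers_bounded A f2 k" "fibers_bounded A f3 k"
    and f: "f1 \<in> A \<rightarrow> carrier G" "f2 \<in> A \<rightarrow> carrier G" "f3 \<in> A \<rightarrow> carrier G"
    and eq: "\<And>a. a \<in> A \<Longrightarrow> f1 a \<otimes> f2 a = f3 a"
    and P1: "\<And>x a. x \<in> A \<Longrightarrow> a \<in> A \<Longrightarrow> x \<otimes> f1 a \<in> P"
    and P3: "\<And>x a. x \<in> A \<Longrightarrow> a \<in> A \<Longrightarrow> x \<otimes> f3 a \<in> P"
    and R: "finite R" "triangles (solution_graph G P (f1 ` A) (f2 ` A) (f3 ` A) - R) = {}"
  shows "card A * card A \<le> k * card R"
proof -
  let ?E = "solution_graph G P (f1 ` A) (f2 ` A) (f3 ` A)"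
  define e1 where "e1 x a = ((x, 0::nat), (x \<otimes> f1 a, 1::nat))" for x a
  define e2 where "e2 x a = ((x \<otimes> f1 a, 1::nat), (x \<otimes> f3 a, 2::nat))" for x a
  define e3 where "e3 x a = ((x, 0::nat), (x \<otimes> f3 a, 2::nat))" for x a
  define Fib where "Fib r = {(x, a) \<in> A \<times> A. r \<in> {e1 x a, e2 x a, e3 x a}}" for r
  have AG: "x \<in> carrier G" if "x \<in> A" for x using that A P by auto
  have fG: "f1 a \<in> carrier G" "f2 a \<in> carrier G" "f3 a \<in> carrier G" if "a \<in> A" for a
    using that f by auto
  have x_f3: "x \<otimes> f3 a = (x \<otimes> f1 a) \<otimes> f2 a" if "x \<in> A" "a \<in> A" for x a
    using that AG fG by (simp add: m_assoc flip: eq)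
  have cover: "A \<times> A \<subseteq> (\<Union>r\<in>R. Fib r)"
  proof clarify
    fix x a assume xa: "x \<in> A" "a \<in> A"
    have "inv (x \<otimes> f1 a) \<otimes> (x \<otimes> f3 a) = f2 a"
      using xa AG fG by (simp add: x_f3 inv_mult_cancel)
    then have "e1 x a \<in> ?E" "e2 x a \<in> ?E" "e3 x a \<in> ?E"
      using xa AG fG P1 P3 A by (auto simp: e1_def e2_def e3_def solution_graph_def inv_mult_cancel)
    moreover have "\<not> (e1 x a \<in> ?E - R \<and> e2 x a \<in> ?E - R \<and> e3 x a \<in> ?E - R)"
      using R(2) unfolding triangles_def e1_def e2_def e3_def by blast
    ultimately obtain r where "r \<in> R" "r \<in> {e1 x a, e2 x a, e3 x a}" by blast
    then show "(x, a) \<in> (\<Union>r\<in>R. Fib r)" using xa by (auto simp: Fib_def)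
  qed
  have card_Fib: "card (Fib r) \<le> k" for r
  proof (cases "Fib r = {}")
    case False
    then obtain x0 a0 where 0: "x0 \<in> A" "a0 \<in> A" "r \<in> {e1 x0 a0, e2 x0 a0, e3 x0 a0}"
      by (auto simp: Fib_def)
    \<comment> \<open>An edge fixes the value of one of the three functions at \<open>a\<close>,
      which leaves at most \<open>k\<close> choices of \<open>a\<close>, and with \<open>a\<close>
      it fixes \<open>x\<close>.\<close>
    have bound: "card (Fib r) \<le> k" if "fibers_bounded A f k"
      and "\<And>x a. (x, a) \<in> Fib r \<Longrightarrow> f a = f a0"
      and "\<And>x x' a. \<lbrakk>(x, a) \<in> Fib r; (x', a) \<in> Fib r\<rbrakk> \<Longrightarrow> x = x'" for f
    proof -
      have "inj_on snd (Fib r)" using that(3) by (intro inj_onI) auto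
      moreover have "Fib r \<subseteq> A \<times> A" by (auto simp: Fib_def)
      then have "snd ` Fib r \<subseteq> {a \<in> A. f a = f a0}" using that(2) by fastforce
      ultimately have "card (Fib r) \<le> card {a \<in> A. f a = f a0}"
        using A by (intro card_inj_on_le[of snd]) auto
      then show ?thesis using that(1) by (auto simp: fibers_bounded_def intro: order.trans)
    qed
    from 0(3) consider "r = e1 x0 a0" | "r = e2 x0 a0" | "r = e3 x0 a0" by blast
    then show ?thesis
    proof cases
      case 1
      have "x = x0 \<and> f1 a = f1 a0" if "(x, a) \<in> Fib r" for x a
        using that 0 AG fG by (auto simp: Fib_def 1 e1_def e2_def e3_def)
      then show ?thesis by (intro bound[OF fib(1)]) blast+
    next
      \<comment> \<open>The edge shows neither \<open>x\<close> nor \<open>f2 a\<close> directly: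
        cancelling its first endpoint from its second gives \<open>f2 a\<close>, and once
        \<open>a\<close> is known, cancelling \<open>f1 a\<close> gives \<open>x\<close>.\<close>
      case 2
      have *: "x \<otimes> f1 a = x0 \<otimes> f1 a0 \<and> x \<otimes> f3 a = x0 \<otimes> f3 a0 \<and> x \<in> A \<and> a \<in> A" if "(x, a) \<in> Fib r" for x a
        using that by (auto simp: Fib_def 2 e1_def e2_def e3_def)
      have "f2 a = f2 a0" if "(x, a) \<in> Fib r" for x a
      proof -
        have "(x0 \<otimes> f1 a0) \<otimes> f2 a = (x0 \<otimes> f1 a0) \<otimes> f2 a0"
          using *[OF that] x_f3[of x a] x_f3[OF 0(1,2)] by simp
        moreover have "x0 \<otimes> f1 a0 \<in> carrier G" "f2 a \<in> carrier G" "f2 a0 \<in> carrier G"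
          using *[OF that] 0 AG fG by auto
        ultimately show ?thesis by simp
      qed
      moreover have "x = x'" if "(x, a) \<in> Fib r" "(x', a) \<in> Fib r" for x x' a
      proof -
        have "x \<otimes> f1 a = x' \<otimes> f1 a" "x \<in> A" "x' \<in> A" "a \<in> A" using *[OF that(1)] *[OF that(2)] by auto
        then show ?thesis using AG fG by simp
      qed
      ultimately show ?thesis by (intro bound[OF fib(2)]) blast+
    next
      case 3
      have "x = x0 \<and> f3 a = f3 a0" if "(x, a) \<in> Fib r" for x a
        using that 0 AG fG by (auto simp: Fib_def 3 e1_def e2_def e3_def)
      then show ?thesis by (intro bound[OF fib(3)]) blast+
    qed
  qed simp
  have "card A * card A = card (A \<times> A)" by (simp add: card_cartesian_product)
  also have "\<dots> \<le> card (\<Union>r\<in>R. Fib r)"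
  proof (rule card_mono[OF _ cover])
    have "finite (Fib r)" for r by (rule finite_subset[of _ "A \<times> A"]) (use A in \<open>auto simp: Fib_def\<close>)
    then show "finite (\<Union>r\<in>R. Fib r)" using R by blast
  qed
  also have "\<dots> \<le> (\<Sum>r\<in>R. card (Fib r))" by (rule card_UN_le[OF R(1)])
  also have "\<dots> \<le> (\<Sum>r\<in>R. k)" by (rule sum_mono[OF card_Fib])
  finally show ?thesis by (simp add: mult.commute)
qed

end

text \<open>Triangle removal is used on vertices of type \<open>'a \<times> nat\<close>, so formally
  the constant may still vary with the type of the group elements.\<close>

lemma many_solutions_uniform:
  fixes K :: real and k m :: nat
  assumes K: "K \<ge> 1" and k: "k \<ge> 1"
  shows "\<exists>\<eta>>0. \<forall>G :: ('a, 'b) monoid_scheme. group G \<longrightarrow> many_solutions G K k m \<eta>"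
proof -
  \<comment> \<open>The growth factor of the product set \<open>P\<close> with \<open>Suc m\<close>
    factors introduced below.\<close>
  define C where "C = (27 * K ^ 3) ^ Suc (Suc m)"
  have C: "C > 0" using K by (simp add: C_def)
  \<comment> \<open>Chosen so that \<open>k * (\<epsilon> * (3 * (C * ?a))\<^sup>2)\<close> is
    \<open>9 / 10 * ?a\<^sup>2\<close>, strictly below the \<open>?a\<^sup>2\<close> that any
    removal of all triangles requires.\<close>
  define \<epsilon> where "\<epsilon> = 1 / (10 * C\<^sup>2 * k)"
  have \<epsilon>: "\<epsilon> > 0" using C k by (simp add: \<epsilon>_def)
  obtain \<delta> where \<delta>: "\<delta> > 0" and removal:
    "\<And>(V :: ('a \<times> nat) set) E. \<lbrakk>finite V; E \<subseteq> V \<times> V; real (card (triangles E)) < \<delta> * real (card V) ^ 3\<rbrakk> \<Longrightarrow>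
      \<exists>R\<subseteq>E. real (card R) \<le> \<epsilon> * (real (card V))\<^sup>2 \<and> triangles (E - R) = {}"
    using triangle_removal[OF \<epsilon>] by blast
  have "many_solutions G K k m \<delta>" if "group G" for G :: "('a, 'b) monoid_scheme"
    unfolding many_solutions_def
  proof (intro allI impI)
    interpret group G by fact
    fix A f1 f2 f3
    assume A: "A \<subseteq> carrier G" "finite A" and tripling: "real (card (A <#>\<^bsub>G\<^esub> A <#>\<^bsub>G\<^esub> A)) \<le> K * real (card A)"
      and f: "f1 \<in> A \<rightarrow> sym_prod G A m" "f2 \<in> A \<rightarrow> sym_prod G A m" "f3 \<in> A \<rightarrow> sym_prod G A m"
      and fib: "fibers_bounded A f1 k" "fibers_bounded A f2 k" "fibers_bounded A f3 k"
      and eq: "\<forall>a\<in>A. f1 a \<otimes>\<^bsub>G\<^esub> f2 a = f3 a"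
    let ?sol = "{(a1, a2, a3). a1 \<in> A \<and> a2 \<in> A \<and> a3 \<in> A \<and> f1 a1 \<otimes>\<^bsub>G\<^esub> f2 a2 = f3 a3}"
    let ?S = "{(s1, s2, s3). s1 \<in> f1 ` A \<and> s2 \<in> f2 ` A \<and> s3 \<in> f3 ` A \<and> s1 \<otimes>\<^bsub>G\<^esub> s2 = s3}"
    show "\<delta> * (real (card A))\<^sup>2 \<le> real (card ?sol)"
    proof (cases "A = {}")
      case False
      let ?a = "real (card A)"
      have a: "?a > 0" using A False by (simp add: card_gt_0_iff)
      \<comment> \<open>One factor more than \<open>m\<close>, so that
        \<open>x \<otimes> f1 a\<close> and \<open>x \<otimes> f3 a\<close> stay in \<open>P\<close>
        for \<open>x\<close> in \<open>A\<close>.\<close>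
      define P where "P = sym_prod G A (Suc m)"
      have P: "finite P" "P \<subseteq> carrier G"
        unfolding P_def by (rule finite_sym_prod[OF A(2)], rule sym_prod_subset_carrier[OF A(1)])
      have P_eq: "P = sym_closure G A <#>\<^bsub>G\<^esub> sym_prod G A m"
        using sym_prod_add[OF A(1), of "Suc 0" m] sym_prod_1[OF A(1)] by (simp add: P_def)
      have P_le: "real (card P) \<le> C * ?a"
        unfolding P_def C_def by (rule card_sym_prod_le[OF A(2,1) False K tripling])
      have mem_P: "x \<otimes>\<^bsub>G\<^esub> s \<in> P" if "x \<in> A" "s \<in> sym_prod G A m" for x s
        unfolding P_eq using that by (auto simp: set_mult_def sym_closure_def)
      have AP: "A \<subseteq> P"
      proof
        fix x assume x: "x \<in> A"
        have "\<one>\<^bsub>G\<^esub> \<in> sym_prod G A m" using sym_prod_mono[OF A(1), of 0 m] by simp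
        then have "x \<otimes>\<^bsub>G\<^esub> \<one>\<^bsub>G\<^esub> \<in> P" using x mem_P by blast
        then show "x \<in> P" using x A by (simp add: subset_iff)
      qed
      have "card A \<le> card P" by (rule card_mono[OF P(1) AP])
      have fG: "f1 \<in> A \<rightarrow> carrier G" "f2 \<in> A \<rightarrow> carrier G" "f3 \<in> A \<rightarrow> carrier G"
        using f sym_prod_subset_carrier[OF A(1), of m] by blast+
      let ?E = "solution_graph G P (f1 ` A) (f2 ` A) (f3 ` A)"
      define V where "V = P \<times> {0, 1, 2 :: nat}"
      have V: "finite V" and EV: "?E \<subseteq> V \<times> V" and card_V: "card V = 3 * card P"
        using P by (auto simp: V_def solution_graph_def card_cartesian_product)
      have "\<not> real (card (triangles ?E)) < \<delta> * real (card V) ^ 3"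
      proof
        assume "real (card (triangles ?E)) < \<delta> * real (card V) ^ 3"
        then obtain R where R: "R \<subseteq> ?E" "real (card R) \<le> \<epsilon> * (real (card V))\<^sup>2" "triangles (?E - R) = {}"
          using removal[OF V EV] by blast
        have "finite R" using R(1) EV V by (meson finite_SigmaI finite_subset)
        have "x \<otimes>\<^bsub>G\<^esub> f1 a \<in> P" "x \<otimes>\<^bsub>G\<^esub> f3 a \<in> P" if "x \<in> A" "a \<in> A" for x a
          using that f by (auto intro!: mem_P)
        then have "card A * card A \<le> k * card R"
          using card_square_le_edge_cover[OF A(2) AP P fib fG bspec[OF eq] _ _ \<open>finite R\<close> R(3)] by blast
        then have "?a\<^sup>2 \<le> k * real (card R)" by (metis of_nat_le_iff of_nat_mult power2_eq_square)
        also have "\<dots> \<le> k * (\<epsilon> * (3 * (C * ?a))\<^sup>2)"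
        proof -
          have "\<epsilon> * (real (card V))\<^sup>2 \<le> \<epsilon> * (3 * (C * ?a))\<^sup>2"
            by (intro mult_left_mono power_mono) (use P_le \<epsilon> in \<open>auto simp: card_V\<close>)
          then show ?thesis using R(2) by (intro mult_left_mono) auto
        qed
        also have "\<dots> = 9 / 10 * ?a\<^sup>2"
          using C k by (simp add: \<epsilon>_def power2_eq_square)
        finally show False using a by simp
      qed
      then have "\<delta> * real (card V) ^ 3 \<le> real (card (triangles ?E))" by simp
      also have "\<dots> \<le> real (card P * card ?S)"
        unfolding of_nat_le_iff by (rule card_triangles_solution_graph_le[OF P]) (use A in auto)
      \<comment> \<open>Solutions among the values lift to solutions among the arguments, so passing
        to \<open>A\<close> loses nothing.\<close>
      also have "card ?S \<le> card ?sol"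
      proof (rule surj_card_le)
        show "finite ?sol" by (rule finite_subset[of _ "A \<times> A \<times> A"]) (use A in auto)
        show "?S \<subseteq> (\<lambda>(a1, a2, a3). (f1 a1, f2 a2, f3 a3)) ` ?sol" by force
      qed
      finally have "\<delta> * real (card V) ^ 3 \<le> real (card P) * real (card ?sol)"
        by (simp add: mult_left_mono)
      \<comment> \<open>One factor \<open>card P\<close> is kept for cancellation; the other two are
        at least \<open>?a\<close>, and the 27 from the three copies of \<open>P\<close> is
        discarded.\<close>
      moreover have "real (card P) * (\<delta> * ?a\<^sup>2) \<le> \<delta> * real (card V) ^ 3"
      proof -
        have "real (card P) * (\<delta> * ?a\<^sup>2) \<le> real (card P) * (\<delta> * (real (card P))\<^sup>2)"
          using \<open>card A \<le> card P\<close> \<delta> by (intro mult_left_mono power_mono) auto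
        also have "\<dots> \<le> 27 * (real (card P) * (\<delta> * (real (card P))\<^sup>2))" using \<delta> by simp
        also have "\<dots> = \<delta> * real (card V) ^ 3" by (simp add: card_V power2_eq_square power3_eq_cube)
        finally show ?thesis .
      qed
      ultimately have "real (card P) * (\<delta> * ?a\<^sup>2) \<le> real (card P) * real (card ?sol)" by linarith
      moreover have "real (card P) > 0" using a \<open>card A \<le> card P\<close> by linarith
      ultimately show ?thesis by simp
    qed simp
  qed
  then show ?thesis using \<delta> by blast
qed

text \<open>The subgroup generated by \<open>A\<close> is countable, so its structure can be copied
  to a set of naturals, where the constant is assumed to work.\<close>

lemma many_solutions_transfer:
  fixes G :: "('a, 'b) monoid_scheme"
  assumes "group G" and nat: "\<And>N :: nat monoid. group N \<Longrightarrow> many_solutions N K k m \<eta>"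
  shows "many_solutions G K k m \<eta>"
  unfolding many_solutions_def
proof (intro allI impI)
  interpret group G by fact
  fix A f1 f2 f3
  assume A: "A \<subseteq> carrier G" "finite A" and tripling: "real (card (A <#>\<^bsub>G\<^esub> A <#>\<^bsub>G\<^esub> A)) \<le> K * real (card A)"
    and f: "f1 \<in> A \<rightarrow> sym_prod G A m" "f2 \<in> A \<rightarrow> sym_prod G A m" "f3 \<in> A \<rightarrow> sym_prod G A m"
    and fib: "fibers_bounded A f1 k" "fibers_bounded A f2 k" "fibers_bounded A f3 k"
    and eq: "\<forall>a\<in>A. f1 a \<otimes>\<^bsub>G\<^esub> f2 a = f3 a"
  \<comment> \<open>\<open>A\<close>, its symmetric products and hence all values of
    \<open>f1\<close>, \<open>f2\<close>, \<open>f3\<close> lie in \<open>C\<close>, so the property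
    for \<open>A\<close> only concerns this subgroup.\<close>
  define C where "C = generate G A"
  have C: "subgroup C G" unfolding C_def by (rule generate_is_subgroup[OF A(1)])
  have CG: "C \<subseteq> carrier G" by (rule subgroup.subset[OF C])
  note closed = subgroup.m_closed[OF C] subgroup.m_inv_closed[OF C] subgroup.one_closed[OF C]
  define h where "h = to_nat_on C"
  have inj: "inj_on h C"
    unfolding h_def by (rule inj_on_to_nat_on) (use countable_generate[OF A(2,1)] in \<open>simp add: C_def\<close>)
  define \<psi> where "\<psi> = inv_into C h"
  have \<psi>: "\<psi> (h x) = x" if "x \<in> C" for x using that inj by (simp add: \<psi>_def)
  have h_eq: "h x = h y \<longleftrightarrow> x = y" if "x \<in> C" "y \<in> C" for x y
    using that inj by (auto dest: inj_onD)
  define N :: "nat monoid" where "N = \<lparr>carrier = h ` C, mult = (\<lambda>u v. h (\<psi> u \<otimes>\<^bsub>G\<^esub> \<psi> v)), one = h \<one>\<^bsub>G\<^esub>\<rparr>"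
  have N_mult: "h x \<otimes>\<^bsub>N\<^esub> h y = h (x \<otimes>\<^bsub>G\<^esub> y)" if "x \<in> C" "y \<in> C" for x y
    using that by (simp add: N_def \<psi>)
  have N_one: "\<one>\<^bsub>N\<^esub> = h \<one>\<^bsub>G\<^esub>" and N_carrier: "carrier N = h ` C" by (simp_all add: N_def)
  have CG': "x \<in> carrier G" if "x \<in> C" for x using that CG by blast
  have N: "group N"
  proof (rule groupI)
    fix u assume "u \<in> carrier N"
    then obtain x where x: "x \<in> C" "u = h x" by (auto simp: N_carrier)
    show "\<one>\<^bsub>N\<^esub> \<otimes>\<^bsub>N\<^esub> u = u" using x closed CG' by (simp add: N_one N_mult)
    have "h (inv\<^bsub>G\<^esub> x) \<otimes>\<^bsub>N\<^esub> u = \<one>\<^bsub>N\<^esub>" using x closed CG' by (simp add: N_one N_mult)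
    then show "\<exists>v\<in>carrier N. v \<otimes>\<^bsub>N\<^esub> u = \<one>\<^bsub>N\<^esub>" using x closed(2) by (auto simp: N_carrier)
  next
    fix u v w assume "u \<in> carrier N" "v \<in> carrier N" "w \<in> carrier N"
    then obtain x y z where "x \<in> C" "u = h x" "y \<in> C" "v = h y" "z \<in> C" "w = h z" by (auto simp: N_carrier)
    then show "u \<otimes>\<^bsub>N\<^esub> v \<otimes>\<^bsub>N\<^esub> w = u \<otimes>\<^bsub>N\<^esub> (v \<otimes>\<^bsub>N\<^esub> w)" using closed CG' by (simp add: N_mult m_assoc)
  next
    fix u v assume "u \<in> carrier N" "v \<in> carrier N"
    then show "u \<otimes>\<^bsub>N\<^esub> v \<in> carrier N" using closed by (auto simp: N_carrier N_mult)
  next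
    show "\<one>\<^bsub>N\<^esub> \<in> carrier N" using closed by (simp add: N_one N_carrier)
  qed
  have N_inv: "inv\<^bsub>N\<^esub> (h x) = h (inv\<^bsub>G\<^esub> x)" if x: "x \<in> C" for x
  proof (rule group.inv_equality[OF N])
    show "h (inv\<^bsub>G\<^esub> x) \<otimes>\<^bsub>N\<^esub> h x = \<one>\<^bsub>N\<^esub>" using x closed CG' by (simp add: N_one N_mult)
  qed (use x closed(2) in \<open>simp_all add: N_carrier\<close>)
  have image_set_mult: "h ` X <#>\<^bsub>N\<^esub> h ` Y = h ` (X <#>\<^bsub>G\<^esub> Y)" if "X \<subseteq> C" "Y \<subseteq> C" for X Y
  proof -
    have "h x \<otimes>\<^bsub>N\<^esub> h y = h (x \<otimes>\<^bsub>G\<^esub> y)" if "x \<in> X" "y \<in> Y" for x y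
      using that \<open>X \<subseteq> C\<close> \<open>Y \<subseteq> C\<close> N_mult by blast
    then show ?thesis by (simp add: set_mult_def image_UN)
  qed
  have card_image_C: "card (h ` X) = card X" if "X \<subseteq> C" for X
    using that inj by (meson card_image inj_on_subset)
  have AC: "A \<subseteq> C" by (auto simp: C_def intro: generate.incl)
  have set_mult_C: "X <#>\<^bsub>G\<^esub> Y \<subseteq> C" if "X \<subseteq> C" "Y \<subseteq> C" for X Y
    using that closed(1) by (auto simp: set_mult_def)
  have closure_C: "sym_closure G A \<subseteq> C"
    using AC closed by (auto simp: sym_closure_def SET_INV_def)
  have prod_C: "sym_prod G A n \<subseteq> C" for n
    by (induction n) (use closed closure_C set_mult_C in simp_all)
  have "inv\<^bsub>N\<^esub> (h x) = h (inv\<^bsub>G\<^esub> x)" if "x \<in> A" for x using that AC N_inv by blast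
  then have closure_N: "sym_closure N (h ` A) = h ` sym_closure G A"
    by (simp add: sym_closure_def SET_INV_def N_one image_Un image_UN)
  have prod_N: "sym_prod N (h ` A) n = h ` sym_prod G A n" for n
    by (induction n) (simp_all add: N_one closure_N image_set_mult prod_C closure_C)
  \<comment> \<open>The functions are transported by conjugation with \<open>h\<close>;
    \<open>\<psi>\<close> inverts \<open>h\<close> on \<open>C\<close>.\<close>
  define g where "g f = h \<circ> f \<circ> \<psi>" for f :: "'a \<Rightarrow> 'a"
  have g: "g f (h a) = h (f a)" if "a \<in> A" for f a using that AC by (simp add: g_def \<psi> subset_iff)
  have fC: "f a \<in> C" if "f \<in> A \<rightarrow> sym_prod G A m" "a \<in> A" for f a
    using that prod_C[of m] by auto
  have g_Pi: "g f \<in> h ` A \<rightarrow> sym_prod N (h ` A) m" if "f \<in> A \<rightarrow> sym_prod G A m" for f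
    using that by (auto simp: g prod_N)
  have g_fib: "fibers_bounded (h ` A) (g f) k" if "f \<in> A \<rightarrow> sym_prod G A m" "fibers_bounded A f k" for f
    unfolding fibers_bounded_def
  proof
    fix y
    \<comment> \<open>If \<open>y\<close> is attained, injectivity of \<open>h\<close> on
      \<open>C\<close> makes this a fibre of \<open>f\<close>; otherwise it is empty.\<close>
    have *: "{b \<in> h ` A. g f b = y} = h ` {a \<in> A. h (f a) = y}" by (auto simp: g)
    show "card {b \<in> h ` A. g f b = y} \<le> k"
    proof (cases "{a \<in> A. h (f a) = y} = {}")
      case False
      then obtain a0 where "a0 \<in> A" "h (f a0) = y" by blast
      then have "h (f a) = y \<longleftrightarrow> f a = f a0" if "a \<in> A" for a
        using h_eq[OF fC fC, of f a f a0] that \<open>f \<in> A \<rightarrow> sym_prod G A m\<close> by auto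
      then have "{a \<in> A. h (f a) = y} = {a \<in> A. f a = f a0}" by auto
      then have "card {b \<in> h ` A. g f b = y} \<le> card {a \<in> A. f a = f a0}"
        unfolding * using A(2) by (simp add: card_image_le)
      then show ?thesis using that(2) by (auto simp: fibers_bounded_def intro: order.trans)
    qed (simp only: * image_empty card.empty le0)
  qed
  have g_prod: "g f1 (h a1) \<otimes>\<^bsub>N\<^esub> g f2 (h a2) = g f3 (h a3) \<longleftrightarrow> f1 a1 \<otimes>\<^bsub>G\<^esub> f2 a2 = f3 a3"
    if "a1 \<in> A" "a2 \<in> A" "a3 \<in> A" for a1 a2 a3
  proof -
    have "f1 a1 \<in> C" "f2 a2 \<in> C" "f3 a3 \<in> C"
      by (rule fC[OF f(1) that(1)], rule fC[OF f(2) that(2)], rule fC[OF f(3) that(3)])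
    then show ?thesis using that closed(1) by (simp add: g N_mult h_eq)
  qed
  let ?solN = "{(b1, b2, b3). b1 \<in> h ` A \<and> b2 \<in> h ` A \<and> b3 \<in> h ` A \<and> g f1 b1 \<otimes>\<^bsub>N\<^esub> g f2 b2 = g f3 b3}"
  let ?sol = "{(a1, a2, a3). a1 \<in> A \<and> a2 \<in> A \<and> a3 \<in> A \<and> f1 a1 \<otimes>\<^bsub>G\<^esub> f2 a2 = f3 a3}"
  have card_hA: "card (h ` A) = card A" by (rule card_image_C[OF AC])
  have "\<eta> * (real (card (h ` A)))\<^sup>2 \<le> real (card ?solN)"
  proof (rule nat[OF N, unfolded many_solutions_def, rule_format])
    show "h ` A \<subseteq> carrier N" using AC by (auto simp: N_carrier)
    show "finite (h ` A)" using A(2) by simp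
    have "h ` A <#>\<^bsub>N\<^esub> h ` A <#>\<^bsub>N\<^esub> h ` A = h ` (A <#>\<^bsub>G\<^esub> A <#>\<^bsub>G\<^esub> A)"
      using AC set_mult_C by (simp add: image_set_mult)
    then show "real (card (h ` A <#>\<^bsub>N\<^esub> h ` A <#>\<^bsub>N\<^esub> h ` A)) \<le> K * real (card (h ` A))"
      using AC set_mult_C card_image_C card_hA tripling by simp
    show "g f1 b \<otimes>\<^bsub>N\<^esub> g f2 b = g f3 b" if "b \<in> h ` A" for b using that eq g_prod by blast
  qed (rule g_Pi g_fib f fib)+
  then have "\<eta> * (real (card A))\<^sup>2 \<le> real (card ?solN)" by (simp only: card_hA)
  \<comment> \<open>Each solution in \<open>N\<close> is the componentwise image under
    \<open>h\<close> of a solution in \<open>G\<close>.\<close>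
  also have "card ?solN \<le> card ?sol"
  proof (rule surj_card_le)
    show "finite ?sol" by (rule finite_subset[of _ "A \<times> A \<times> A"]) (use A in auto)
    show "?solN \<subseteq> (\<lambda>(a1, a2, a3). (h a1, h a2, h a3)) ` ?sol"
      by (clarsimp simp: g_prod image_iff) blast
  qed
  finally show "\<eta> * (real (card A))\<^sup>2 \<le> real (card ?sol)" by simp
qed

theorem theorem5p1:
  fixes K :: real and k m :: nat
  assumes "K \<ge> 1" and "k \<ge> 1" and "m \<ge> 1"
  shows "(\<exists>\<eta>>0. \<forall>G :: nat monoid. group G \<longrightarrow> many_solutions G K k m \<eta>) \<and>
    (\<forall>\<eta>>0. (\<forall>G :: nat monoid. group G \<longrightarrow> many_solutions G K k m \<eta>) \<longrightarrow>
      (\<forall>G :: ('a, 'b) monoid_scheme. group G \<longrightarrow> many_solutions G K k m \<eta>))"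
  using many_solutions_uniform[OF assms(1,2)] many_solutions_transfer by blast

end
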